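(* Let $\pi:(M,\varphi,\xi,\eta,g)\to(N,J,g')$ be a contact-complex Riemannian submersion. Suppose that $M$ satisfies $K_{2\varphi}$. If the O'Neill tensor $A$ is $\varphi$-bilinear, then the base space $N$ satisfies $K_2$.
   Context: All manifolds and maps are $C^\infty$. An almost contact metric manifold $(M,\varphi,\xi,\eta,g)$ has a $(1,1)$-tensor field $\varphi$, a vector field $\xi$, a 1-form $\eta$ and a Riemannian metric $g$ with $\varphi^2=-I+\eta\otimes\xi$, $\eta(\xi)=1$, $g(\varphi X,\varphi Y)=g(X,Y)-\eta(X)\eta(Y)$. A contact-complex Riemannian submersion is a (surjective) Riemannian submersion $\pi:M\to N$ from an almost contact metric manifold onto an almost Hermitian manifold $(N,J,g')$ such that $J\circ d\pi=d\pi\circ\varphi$. The vertical distribution is $\mathcal V=\ker d\pi$, the horizontal distribution $\mathcal H$ is its orthogonal complement, with orthogonal projections $v,h$. It is known that $\xi$ is vertical and $\mathcal V,\mathcal H$ are $\varphi$-invariant. With $\nabla$ the Levi-Civita connection of $g$, the O'Neill tensor $A$ is $A_{\tilde X}\tilde Y=v\nabla_{h\tilde X}h\tilde Y+h\nabla_{h\tilde X}v\tilde Y$. $A$ is $\varphi$-bilinear if $A_{\varphi X}Y=A_X\varphi Y=\varphi A_XY$ for all horizontal $X,Y$. With $R$ the $(0,4)$ Riemann curvature tensor of the Levi-Civita connection of the manifold in question: an almost contact metric manifold satisfies $K_{2\varphi}$ if $R(X,Y,Z,W)=R(\varphi X,Y,Z,\varphi W)+R(X,\varphi Y,Z,\varphi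 W)+R(X,Y,\varphi Z,\varphi W)$ for all vector fields; an almost Hermitian manifold satisfies $K_2$ if $R(X,Y,Z,W)=R(JX,Y,Z,JW)+R(X,JY,Z,JW)+R(X,Y,JZ,JW)$ for all vector fields. *)

theory Defs
  imports "HOL-Analysis.Analysis" "HOL-Library.Function_Algebras"
begin

section \<open>Smooth functions on open subsets of Euclidean space\<close>

primrec Ck_on :: "nat \<Rightarrow> 'a set \<Rightarrow> ('a::euclidean_space \<Rightarrow> 'b::real_normed_vector) \<Rightarrow> bool" where
  "Ck_on 0 S f \<longleftrightarrow> continuous_on S f"
| "Ck_on (Suc k) S f \<longleftrightarrow>
     (\<forall>x\<in>S. f differentiable (at x)) \<and>
     (\<forall>v. Ck_on k S (\<lambda>x. frechet_derivative f (at x) v))"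

definition smooth_on :: "'a set \<Rightarrow> ('a::euclidean_space \<Rightarrow> 'b::real_normed_vector) \<Rightarrow> bool" where
  "smooth_on S f \<longleftrightarrow> (\<forall>k. Ck_on k S f)"

section \<open>Smooth manifolds\<close>

text \<open>A manifold is a Hausdorff second countable type of points together with a smooth atlas
  (not necessarily maximal). A chart is a pair of a coordinate domain and a coordinate map; only
  the values of the coordinate map on the domain are relevant.\<close>

type_synonym ('m, 'e) atlas = "('m set \<times> ('m \<Rightarrow> 'e)) set"

definition smooth_manifold ::
  "('m::{t2_space,second_countable_topology}, 'e::euclidean_space) atlas \<Rightarrow> bool" where
  "smooth_manifold A \<longleftrightarrow>
     (\<forall>(U, x)\<in>A. open U \<and> open (x ` U) \<and> homeomorphism U (x ` U) x (inv_into U x)) \<and>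
     (\<Union>(U, x)\<in>A. U) = UNIV \<and>
     (\<forall>(U, x)\<in>A. \<forall>(V, y)\<in>A. smooth_on (x ` (U \<inter> V)) (y \<circ> inv_into U x))"

definition smooth_fun :: "('m, 'e::euclidean_space) atlas \<Rightarrow> ('m \<Rightarrow> real) \<Rightarrow> bool" where
  "smooth_fun A f \<longleftrightarrow> (\<forall>(U, x)\<in>A. smooth_on (x ` U) (f \<circ> inv_into U x))"

definition smooth_map ::
  "('m::topological_space, 'e::euclidean_space) atlas \<Rightarrow>
   ('n::topological_space, 'd::euclidean_space) atlas \<Rightarrow> ('m \<Rightarrow> 'n) \<Rightarrow> bool" where
  "smooth_map A B \<pi> \<longleftrightarrow> continuous_on UNIV \<pi> \<and>
     (\<forall>(U, x)\<in>A. \<forall>(V, y)\<in>B. smooth_on (x ` (U \<inter> \<pi> -` V)) (y \<circ> \<pi> \<circ> inv_into U x))"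

section \<open>Tangent vectors, vector fields and tensor fields\<close>

text \<open>A tangent vector at \<open>p\<close> is a derivation at \<open>p\<close> of the algebra of smooth functions. As HOL
  functions are total, a tangent vector is set to \<open>0\<close> on functions that are not smooth, so
  that equality of tangent vectors is equality of functions. Sums, differences and zero of tangent
  vectors and of vector fields are the pointwise ones.\<close>

type_synonym 'm tvec = "('m \<Rightarrow> real) \<Rightarrow> real"
type_synonym 'm vfield = "'m \<Rightarrow> 'm tvec"

definition scale_vec :: "real \<Rightarrow> 'm tvec \<Rightarrow> 'm tvec" (infixr \<open>*\<^sub>v\<close> 75) where
  "c *\<^sub>v u = (\<lambda>f. c * u f)"

definition scale_field :: "('m \<Rightarrow> real) \<Rightarrow> 'm vfield \<Rightarrow> 'm vfield" (infixr \<open>*\<^sub>f\<close> 75) where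
  "f *\<^sub>f X = (\<lambda>p. f p *\<^sub>v X p)"

definition tangent_space :: "('m, 'e::euclidean_space) atlas \<Rightarrow> 'm \<Rightarrow> 'm tvec set" where
  "tangent_space A p = {u.
     (\<forall>f g. smooth_fun A f \<longrightarrow> smooth_fun A g \<longrightarrow> u (f + g) = u f + u g) \<and>
     (\<forall>c f. smooth_fun A f \<longrightarrow> u (\<lambda>q. c * f q) = c * u f) \<and>
     (\<forall>f g. smooth_fun A f \<longrightarrow> smooth_fun A g \<longrightarrow> u (f * g) = u f * g p + f p * u g) \<and>
     (\<forall>f. \<not> smooth_fun A f \<longrightarrow> u f = 0)}"

definition deriv_along :: "'m vfield \<Rightarrow> ('m \<Rightarrow> real) \<Rightarrow> 'm \<Rightarrow> real" where
  "deriv_along X f = (\<lambda>p. X p f)"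

definition vector_fields :: "('m, 'e::euclidean_space) atlas \<Rightarrow> 'm vfield set" where
  "vector_fields A = {X. (\<forall>p. X p \<in> tangent_space A p) \<and>
     (\<forall>f. smooth_fun A f \<longrightarrow> smooth_fun A (deriv_along X f))}"

definition lie_bracket :: "'m vfield \<Rightarrow> 'm vfield \<Rightarrow> 'm vfield" where
  "lie_bracket X Y = (\<lambda>p f. X p (deriv_along Y f) - Y p (deriv_along X f))"

text \<open>Tensor fields are given pointwise; their values outside the tangent spaces are irrelevant.\<close>

definition apply_tensor :: "('m \<Rightarrow> 'm tvec \<Rightarrow> 'm tvec) \<Rightarrow> 'm vfield \<Rightarrow> 'm vfield" where
  "apply_tensor F X = (\<lambda>p. F p (X p))"

definition tensor_field_11 ::
  "('m, 'e::euclidean_space) atlas \<Rightarrow> ('m \<Rightarrow> 'm tvec \<Rightarrow> 'm tvec) \<Rightarrow> bool" where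
  "tensor_field_11 A F \<longleftrightarrow>
     (\<forall>p. \<forall>u\<in>tangent_space A p. F p u \<in> tangent_space A p \<and>
        (\<forall>w\<in>tangent_space A p. F p (u + w) = F p u + F p w) \<and>
        (\<forall>c. F p (c *\<^sub>v u) = c *\<^sub>v F p u)) \<and>
     (\<forall>X\<in>vector_fields A. apply_tensor F X \<in> vector_fields A)"

definition one_form ::
  "('m, 'e::euclidean_space) atlas \<Rightarrow> ('m \<Rightarrow> 'm tvec \<Rightarrow> real) \<Rightarrow> bool" where
  "one_form A \<omega> \<longleftrightarrow>
     (\<forall>p. \<forall>u\<in>tangent_space A p.
        (\<forall>w\<in>tangent_space A p. \<omega> p (u + w) = \<omega> p u + \<omega> p w) \<and>
        (\<forall>c. \<omega> p (c *\<^sub>v u) = c * \<omega> p u)) \<and>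
     (\<forall>X\<in>vector_fields A. smooth_fun A (\<lambda>p. \<omega> p (X p)))"

type_synonym 'm metric = "'m \<Rightarrow> 'm tvec \<Rightarrow> 'm tvec \<Rightarrow> real"

text \<open>Linearity in the second argument follows from symmetry.\<close>

definition riemannian_metric ::
  "('m, 'e::euclidean_space) atlas \<Rightarrow> 'm metric \<Rightarrow> bool" where
  "riemannian_metric A g \<longleftrightarrow>
     (\<forall>p. \<forall>u\<in>tangent_space A p. \<forall>w\<in>tangent_space A p.
        g p u w = g p w u \<and>
        (\<forall>c. g p (c *\<^sub>v u) w = c * g p u w) \<and>
        (\<forall>u'\<in>tangent_space A p. g p (u + u') w = g p u w + g p u' w)) \<and>
     (\<forall>p. \<forall>u\<in>tangent_space A p. u \<noteq> 0 \<longrightarrow> g p u u > 0) \<and>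
     (\<forall>X\<in>vector_fields A. \<forall>Y\<in>vector_fields A. smooth_fun A (\<lambda>p. g p (X p) (Y p)))"

definition riemannian_manifold ::
  "('m::{t2_space,second_countable_topology}, 'e::euclidean_space) atlas \<Rightarrow> 'm metric \<Rightarrow> bool" where
  "riemannian_manifold A g \<longleftrightarrow> smooth_manifold A \<and> riemannian_metric A g"

section \<open>Levi-Civita connection and curvature\<close>

text \<open>\<open>D X Y\<close> is the covariant derivative of \<open>Y\<close> along \<open>X\<close>. The conditions determine \<open>D\<close>
  uniquely on smooth vector fields.\<close>

type_synonym 'm connection = "'m vfield \<Rightarrow> 'm vfield \<Rightarrow> 'm vfield"

definition affine_connection ::
  "('m, 'e::euclidean_space) atlas \<Rightarrow> 'm connection \<Rightarrow> bool" where
  "affine_connection A D \<longleftrightarrow>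
     (\<forall>X\<in>vector_fields A. \<forall>Y\<in>vector_fields A. D X Y \<in> vector_fields A \<and>
        (\<forall>Z\<in>vector_fields A. D (X + Z) Y = D X Y + D Z Y \<and> D X (Y + Z) = D X Y + D X Z) \<and>
        (\<forall>f. smooth_fun A f \<longrightarrow>
           D (f *\<^sub>f X) Y = f *\<^sub>f D X Y \<and>
           D X (f *\<^sub>f Y) = deriv_along X f *\<^sub>f Y + f *\<^sub>f D X Y))"

definition levi_civita_connection ::
  "('m, 'e::euclidean_space) atlas \<Rightarrow> 'm metric \<Rightarrow> 'm connection \<Rightarrow> bool" where
  "levi_civita_connection A g D \<longleftrightarrow> affine_connection A D \<and>
     (\<forall>X\<in>vector_fields A. \<forall>Y\<in>vector_fields A. D X Y - D Y X = lie_bracket X Y) \<and>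
     (\<forall>X\<in>vector_fields A. \<forall>Y\<in>vector_fields A. \<forall>Z\<in>vector_fields A.
        deriv_along X (\<lambda>p. g p (Y p) (Z p)) =
          (\<lambda>p. g p (D X Y p) (Z p) + g p (Y p) (D X Z p)))"

definition curvature_operator ::
  "'m connection \<Rightarrow> 'm vfield \<Rightarrow> 'm vfield \<Rightarrow> 'm vfield \<Rightarrow> 'm vfield" where
  "curvature_operator D X Y Z = D X (D Y Z) - D Y (D X Z) - D (lie_bracket X Y) Z"

text \<open>The identities below are linear in the curvature tensor and hence do not depend on its sign
  convention.\<close>

definition curvature ::
  "'m metric \<Rightarrow> 'm connection \<Rightarrow> 'm vfield \<Rightarrow> 'm vfield \<Rightarrow> 'm vfield \<Rightarrow> 'm vfield \<Rightarrow> 'm \<Rightarrow> real" where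
  "curvature g D X Y Z W = (\<lambda>p. g p (curvature_operator D X Y Z p) (W p))"

section \<open>Almost contact metric and almost Hermitian manifolds\<close>

definition almost_contact_metric_manifold ::
  "('m::{t2_space,second_countable_topology}, 'e::euclidean_space) atlas \<Rightarrow>
   ('m \<Rightarrow> 'm tvec \<Rightarrow> 'm tvec) \<Rightarrow> 'm vfield \<Rightarrow> ('m \<Rightarrow> 'm tvec \<Rightarrow> real) \<Rightarrow> 'm metric \<Rightarrow> bool" where
  "almost_contact_metric_manifold A \<phi> \<xi> \<eta> g \<longleftrightarrow>
     riemannian_manifold A g \<and> tensor_field_11 A \<phi> \<and> \<xi> \<in> vector_fields A \<and> one_form A \<eta> \<and>
     (\<forall>p. \<forall>u\<in>tangent_space A p. \<phi> p (\<phi> p u) = - u + \<eta> p u *\<^sub>v \<xi> p) \<and>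
     (\<forall>p. \<eta> p (\<xi> p) = 1) \<and>
     (\<forall>p. \<forall>u\<in>tangent_space A p. \<forall>w\<in>tangent_space A p.
        g p (\<phi> p u) (\<phi> p w) = g p u w - \<eta> p u * \<eta> p w)"

definition almost_hermitian_manifold ::
  "('m::{t2_space,second_countable_topology}, 'e::euclidean_space) atlas \<Rightarrow>
   ('m \<Rightarrow> 'm tvec \<Rightarrow> 'm tvec) \<Rightarrow> 'm metric \<Rightarrow> bool" where
  "almost_hermitian_manifold A J g \<longleftrightarrow>
     riemannian_manifold A g \<and> tensor_field_11 A J \<and>
     (\<forall>p. \<forall>u\<in>tangent_space A p. J p (J p u) = - u) \<and>
     (\<forall>p. \<forall>u\<in>tangent_space A p. \<forall>w\<in>tangent_space A p. g p (J p u) (J p w) = g p u w)"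

definition K2phi ::
  "('m, 'e::euclidean_space) atlas \<Rightarrow> ('m \<Rightarrow> 'm tvec \<Rightarrow> 'm tvec) \<Rightarrow> 'm metric \<Rightarrow>
   'm connection \<Rightarrow> bool" where
  "K2phi A \<phi> g D \<longleftrightarrow>
     (\<forall>X\<in>vector_fields A. \<forall>Y\<in>vector_fields A. \<forall>Z\<in>vector_fields A. \<forall>W\<in>vector_fields A.
        curvature g D X Y Z W =
          curvature g D (apply_tensor \<phi> X) Y Z (apply_tensor \<phi> W) +
          curvature g D X (apply_tensor \<phi> Y) Z (apply_tensor \<phi> W) +
          curvature g D X Y (apply_tensor \<phi> Z) (apply_tensor \<phi> W))"

definition K2 ::
  "('m, 'e::euclidean_space) atlas \<Rightarrow> ('m \<Rightarrow> 'm tvec \<Rightarrow> 'm tvec) \<Rightarrow> 'm metric \<Rightarrow>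
   'm connection \<Rightarrow> bool" where
  "K2 A J g D \<longleftrightarrow>
     (\<forall>X\<in>vector_fields A. \<forall>Y\<in>vector_fields A. \<forall>Z\<in>vector_fields A. \<forall>W\<in>vector_fields A.
        curvature g D X Y Z W =
          curvature g D (apply_tensor J X) Y Z (apply_tensor J W) +
          curvature g D X (apply_tensor J Y) Z (apply_tensor J W) +
          curvature g D X Y (apply_tensor J Z) (apply_tensor J W))"

section \<open>Riemannian submersions and the O'Neill tensor\<close>

text \<open>The differential of \<open>\<pi>\<close>, with \<open>B\<close> the atlas of the target. The base point is implicit in
  the derivation \<open>u\<close>.\<close>

definition differential ::
  "('n, 'd::euclidean_space) atlas \<Rightarrow> ('m \<Rightarrow> 'n) \<Rightarrow> 'm tvec \<Rightarrow> 'n tvec" where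
  "differential B \<pi> u = (\<lambda>f. if smooth_fun B f then u (f \<circ> \<pi>) else 0)"

definition vertical_space ::
  "('m, 'e::euclidean_space) atlas \<Rightarrow> ('n, 'd::euclidean_space) atlas \<Rightarrow> ('m \<Rightarrow> 'n) \<Rightarrow>
   'm \<Rightarrow> 'm tvec set" where
  "vertical_space A B \<pi> p = {u \<in> tangent_space A p. differential B \<pi> u = 0}"

definition horizontal_space ::
  "('m, 'e::euclidean_space) atlas \<Rightarrow> 'm metric \<Rightarrow> ('n, 'd::euclidean_space) atlas \<Rightarrow>
   ('m \<Rightarrow> 'n) \<Rightarrow> 'm \<Rightarrow> 'm tvec set" where
  "horizontal_space A g B \<pi> p =
     {u \<in> tangent_space A p. \<forall>w\<in>vertical_space A B \<pi> p. g p u w = 0}"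

definition riemannian_submersion ::
  "('m::{t2_space,second_countable_topology}, 'e::euclidean_space) atlas \<Rightarrow> 'm metric \<Rightarrow>
   ('n::{t2_space,second_countable_topology}, 'd::euclidean_space) atlas \<Rightarrow> 'n metric \<Rightarrow>
   ('m \<Rightarrow> 'n) \<Rightarrow> bool" where
  "riemannian_submersion A g B g' \<pi> \<longleftrightarrow>
     riemannian_manifold A g \<and> riemannian_manifold B g' \<and> smooth_map A B \<pi> \<and> surj \<pi> \<and>
     (\<forall>p. differential B \<pi> ` tangent_space A p = tangent_space B (\<pi> p)) \<and>
     (\<forall>p. \<forall>u\<in>horizontal_space A g B \<pi> p. \<forall>w\<in>horizontal_space A g B \<pi> p.
        g' (\<pi> p) (differential B \<pi> u) (differential B \<pi> w) = g p u w)"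

definition contact_complex_submersion ::
  "('m::{t2_space,second_countable_topology}, 'e::euclidean_space) atlas \<Rightarrow>
   ('m \<Rightarrow> 'm tvec \<Rightarrow> 'm tvec) \<Rightarrow> 'm vfield \<Rightarrow> ('m \<Rightarrow> 'm tvec \<Rightarrow> real) \<Rightarrow> 'm metric \<Rightarrow>
   ('n::{t2_space,second_countable_topology}, 'd::euclidean_space) atlas \<Rightarrow>
   ('n \<Rightarrow> 'n tvec \<Rightarrow> 'n tvec) \<Rightarrow> 'n metric \<Rightarrow> ('m \<Rightarrow> 'n) \<Rightarrow> bool" where
  "contact_complex_submersion A \<phi> \<xi> \<eta> g B J g' \<pi> \<longleftrightarrow>
     almost_contact_metric_manifold A \<phi> \<xi> \<eta> g \<and> almost_hermitian_manifold B J g' \<and>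
     riemannian_submersion A g B g' \<pi> \<and>
     (\<forall>p. \<forall>u\<in>tangent_space A p. J (\<pi> p) (differential B \<pi> u) = differential B \<pi> (\<phi> p u))"

definition horizontal_proj ::
  "('m, 'e::euclidean_space) atlas \<Rightarrow> 'm metric \<Rightarrow> ('n, 'd::euclidean_space) atlas \<Rightarrow>
   ('m \<Rightarrow> 'n) \<Rightarrow> 'm vfield \<Rightarrow> 'm vfield" where
  "horizontal_proj A g B \<pi> X = (\<lambda>p.
     THE w. w \<in> horizontal_space A g B \<pi> p \<and> X p - w \<in> vertical_space A B \<pi> p)"

definition vertical_proj ::
  "('m, 'e::euclidean_space) atlas \<Rightarrow> 'm metric \<Rightarrow> ('n, 'd::euclidean_space) atlas \<Rightarrow>
   ('m \<Rightarrow> 'n) \<Rightarrow> 'm vfield \<Rightarrow> 'm vfield" where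
  "vertical_proj A g B \<pi> X = (\<lambda>p.
     THE w. w \<in> vertical_space A B \<pi> p \<and> X p - w \<in> horizontal_space A g B \<pi> p)"

definition oneill_A ::
  "('m, 'e::euclidean_space) atlas \<Rightarrow> 'm metric \<Rightarrow> 'm connection \<Rightarrow>
   ('n, 'd::euclidean_space) atlas \<Rightarrow> ('m \<Rightarrow> 'n) \<Rightarrow> 'm vfield \<Rightarrow> 'm vfield \<Rightarrow> 'm vfield" where
  "oneill_A A g D B \<pi> X Y =
     (let h = horizontal_proj A g B \<pi>; v = vertical_proj A g B \<pi>
      in v (D (h X) (h Y)) + h (D (h X) (v Y)))"

definition horizontal_fields ::
  "('m, 'e::euclidean_space) atlas \<Rightarrow> 'm metric \<Rightarrow> ('n, 'd::euclidean_space) atlas \<Rightarrow>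
   ('m \<Rightarrow> 'n) \<Rightarrow> 'm vfield set" where
  "horizontal_fields A g B \<pi> = {X \<in> vector_fields A. \<forall>p. X p \<in> horizontal_space A g B \<pi> p}"

definition phi_bilinear ::
  "('m, 'e::euclidean_space) atlas \<Rightarrow> ('m \<Rightarrow> 'm tvec \<Rightarrow> 'm tvec) \<Rightarrow> 'm metric \<Rightarrow>
   ('n, 'd::euclidean_space) atlas \<Rightarrow> ('m \<Rightarrow> 'n) \<Rightarrow>
   ('m vfield \<Rightarrow> 'm vfield \<Rightarrow> 'm vfield) \<Rightarrow> bool" where
  "phi_bilinear A \<phi> g B \<pi> T \<longleftrightarrow>
     (\<forall>X\<in>horizontal_fields A g B \<pi>. \<forall>Y\<in>horizontal_fields A g B \<pi>.
        T (apply_tensor \<phi> X) Y = T X (apply_tensor \<phi> Y) \<and>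
        T X (apply_tensor \<phi> Y) = apply_tensor \<phi> (T X Y))"

end

theory Submission
  imports Defs
begin

text \<open>Vector fields on \<open>N\<close> have smooth horizontal lifts: locally the lift is a combination of the
  gradients of the pulled back coordinate functions. For lifts, the vertical part of the connection
  is the O'Neill tensor \<open>A\<close>, and O'Neill's formula expresses the curvature of \<open>N\<close> as that of \<open>M\<close>
  plus three terms quadratic in \<open>A\<close>. The lift of \<open>J X\<close> is \<open>\<phi> X\<close>, so the identity for the curvature
  of \<open>M\<close> passes to \<open>N\<close> once each quadratic term satisfies it separately. By \<open>\<phi>\<close>-bilinearity this
  reduces to \<open>\<phi>\<close> being a complex isometry on the values of \<open>A\<close>, that is, to \<open>\<eta> (A X Y) = 0\<close>, which holds
  because \<open>\<phi> (\<phi> (A X Y)) = A (\<phi> (\<phi> X)) Y = - A X Y\<close>.\<close>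

section \<open>Calculus of smooth functions\<close>


text \<open>Tangent vectors are derivations on globally smooth functions, and vector fields are
  global as well, so nothing can simply be restricted to a chart. Coordinates, reciprocals,
  coordinate fields and gradients are therefore replaced by global objects that agree with the
  intended local ones only near a point. This is why bump functions come early and why so many
  statements hold eventually at \<open>nhds p\<close>. Hadamard's lemma is needed because it shows
  that every derivation is a combination of partial derivatives. Building lifts from gradients rests
  directly on the surjectivity of \<open>d\<pi>\<close>, and avoids both submersion charts and a
  smooth projection onto the horizontal spaces. The two connections are never compared directly: for
  lifts, metric products and brackets descend to N, and the Koszul formula transfers this to the
  connections.\<close>

lemma Ck_on_cong:
  assumes "open S" "Ck_on k S f" "\<And>x. x \<in> S \<Longrightarrow> f x = g x"
  shows "Ck_on k S g"
  using assms(2,3)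
proof (induction k arbitrary: f g)
  case 0
  then show ?case by (simp cong: continuous_on_cong)
next
  case (Suc k)
  \<comment> \<open>\<open>Ck_on\<close> uses the unrestricted derivative at x; as S is open,
    agreement on S is agreement near x.\<close>
  have der: "(g has_derivative frechet_derivative f (at x)) (at x)" if "x \<in> S" for x
  proof -
    have "(f has_derivative frechet_derivative f (at x)) (at x)"
      using Suc.prems(1) that by (simp add: frechet_derivative_works)
    then show ?thesis
      using has_derivative_transform_within_open[OF _ \<open>open S\<close> that] Suc.prems(2) by metis
  qed
  then have eq: "frechet_derivative f (at x) = frechet_derivative g (at x)" if "x \<in> S" for x
    using that frechet_derivative_at by blast
  have "Ck_on k S (\<lambda>x. frechet_derivative g (at x) v)" for v
    by (rule Suc.IH[of "\<lambda>x. frechet_derivative f (at x) v"]) (use Suc.prems(1) eq in auto)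
  then show ?case
    using der by (auto simp: differentiable_def)
qed

text \<open>Replaces \<open>frechet_derivative\<close> by any formula for the derivative, so that
  the closure properties can be read off from the \<open>has_derivative\<close> rules.\<close>

lemma Ck_on_SucI:
  assumes "open S" "\<And>x. x \<in> S \<Longrightarrow> (f has_derivative f' x) (at x)"
    and "\<And>v. Ck_on k S (\<lambda>x. f' x v)"
  shows "Ck_on (Suc k) S f"
proof -
  have "Ck_on k S (\<lambda>x. frechet_derivative f (at x) v)" for v
    by (rule Ck_on_cong[OF assms(1) assms(3)[of v]]) (metis assms(2) frechet_derivative_at)
  then show ?thesis
    using assms(2) by (auto simp: differentiable_def)
qed

lemma Ck_on_SucD:
  assumes "Ck_on (Suc k) S f"
  shows "x \<in> S \<Longrightarrow> (f has_derivative frechet_derivative f (at x)) (at x)"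
    and "Ck_on k S (\<lambda>x. frechet_derivative f (at x) v)"
  using assms by (auto simp: frechet_derivative_works)

lemma Ck_on_less: "Ck_on (Suc k) S f \<Longrightarrow> Ck_on k S f"
proof (induction k arbitrary: f)
  case 0
  then show ?case
    by (simp add: differentiable_imp_continuous_on differentiable_on_def differentiable_at_withinI)
next
  case (Suc k)
  then show ?case by simp
qed

lemma Ck_on_continuous: "Ck_on k S f \<Longrightarrow> continuous_on S f"
  by (induction k) (use Ck_on_less Ck_on.simps(1) in blast)+

lemma Ck_on_subset: "Ck_on k T f \<Longrightarrow> S \<subseteq> T \<Longrightarrow> Ck_on k S f"
  by (induction k arbitrary: f) (auto intro: continuous_on_subset)

lemma Ck_on_const: "Ck_on k S (\<lambda>x. c)"
  by (induction k arbitrary: c) auto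

lemma Ck_on_Union:
  assumes "\<And>T. T \<in> \<T> \<Longrightarrow> open T" "\<And>T. T \<in> \<T> \<Longrightarrow> Ck_on k T f"
  shows "Ck_on k (\<Union>\<T>) f"
  using assms(2)
proof (induction k arbitrary: f)
  case 0
  then show ?case
    using continuous_on_open_Union[of \<T> f] assms(1) by simp
next
  case (Suc k)
  then show ?case by auto
qed

lemma Ck_on_bounded_linear:
  assumes "open S" "bounded_linear L" "Ck_on k S f"
  shows "Ck_on k S (\<lambda>x. L (f x))"
  using assms(3)
proof (induction k arbitrary: f)
  case 0
  then show ?case
    by (simp add: bounded_linear.continuous_on[OF assms(2)])
next
  case (Suc k)
  show ?case
    by (rule Ck_on_SucI[OF \<open>open S\<close> bounded_linear.has_derivative[OF assms(2)]])
       (use Ck_on_SucD[OF Suc.prems] Suc.IH in auto)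
qed

lemma Ck_on_ident:
  assumes "open S"
  shows "Ck_on k S (\<lambda>x. x)"
proof (cases k)
  case (Suc m)
  show ?thesis unfolding Suc
    by (rule Ck_on_SucI[OF assms, where f' = "\<lambda>x v. v"]) (auto intro: Ck_on_const)
qed simp

lemma Ck_on_add:
  assumes "open S" "Ck_on k S f" "Ck_on k S g"
  shows "Ck_on k S (\<lambda>x. f x + g x)"
  using assms(2,3)
proof (induction k arbitrary: f g)
  case 0
  then show ?case by (simp add: continuous_on_add)
next
  case (Suc k)
  show ?case
    by (rule Ck_on_SucI[OF \<open>open S\<close> has_derivative_add])
       (use Ck_on_SucD[OF Suc.prems(1)] Ck_on_SucD[OF Suc.prems(2)] Suc.IH in auto)
qed

lemma Ck_on_sum:
  assumes "open S" "\<And>i. i \<in> I \<Longrightarrow> Ck_on k S (f i)"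
  shows "Ck_on k S (\<lambda>x. \<Sum>i\<in>I. f i x)"
  using assms(2)
  by (induction I rule: infinite_finite_induct) (auto intro: Ck_on_const Ck_on_add[OF assms(1)])

lemma Ck_on_mult:
  fixes f g :: "'a::euclidean_space \<Rightarrow> real"
  assumes "open S" "Ck_on k S f" "Ck_on k S g"
  shows "Ck_on k S (\<lambda>x. f x * g x)"
  using assms(2,3)
proof (induction k arbitrary: f g)
  case 0
  then show ?case by (simp add: continuous_on_mult)
next
  case (Suc k)
  \<comment> \<open>The product rule contains f and g themselves, which the induction hypothesis
    takes one order lower.\<close>
  show ?case
    by (rule Ck_on_SucI[OF \<open>open S\<close> has_derivative_mult])
       (use Ck_on_SucD[OF Suc.prems(1)] Ck_on_SucD[OF Suc.prems(2)] Ck_on_less[OF Suc.prems(1)] 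
         Ck_on_less[OF Suc.prems(2)] in \<open>auto intro!: Suc.IH Ck_on_add[OF \<open>open S\<close>]\<close>)
qed

text \<open>The induction keeps f fixed: the derivative of the reciprocal is a product of the
  derivative of f with two copies of the same reciprocal.\<close>

lemma Ck_on_inverse:
  fixes f :: "'a::euclidean_space \<Rightarrow> real"
  assumes "open S" "Ck_on k S f" "\<And>x. x \<in> S \<Longrightarrow> f x \<noteq> 0"
  shows "Ck_on k S (\<lambda>x. inverse (f x))"
  using assms(2)
proof (induction k)
  case 0
  then show ?case using assms(3) by (auto intro!: continuous_on_inverse)
next
  case (Suc k)
  have inv: "Ck_on k S (\<lambda>x. inverse (f x))"
    by (rule Suc.IH[OF Ck_on_less[OF Suc.prems]])
  have m1: "Ck_on k S (\<lambda>x. - c x)" if "Ck_on k S c" for c :: "'a \<Rightarrow> real"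
    using Ck_on_bounded_linear[OF \<open>open S\<close> bounded_linear_minus[OF bounded_linear_ident] that] by simp
  have "((\<lambda>x. inverse (f x)) has_derivative
      (\<lambda>v. - (inverse (f x) * frechet_derivative f (at x) v * inverse (f x)))) (at x)" if "x \<in> S" for x
    by (rule Deriv.has_derivative_inverse[OF assms(3)[OF that] Ck_on_SucD(1)[OF Suc.prems that]])
  then show ?case
    by (rule Ck_on_SucI[OF \<open>open S\<close>])
       (use Ck_on_SucD[OF Suc.prems] inv in \<open>auto intro!: m1 Ck_on_mult[OF \<open>open S\<close>]\<close>)
qed

lemma linear_euclidean_sum:
  assumes "linear L"
  shows "L v = (\<Sum>i\<in>Basis. (v \<bullet> i) *\<^sub>R L i)"
  using linear_sum[OF assms, of "\<lambda>i. (v \<bullet> i) *\<^sub>R i" Basis]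
  by (simp add: euclidean_representation linear_scale[OF assms])

text \<open>\<open>Ck_on\<close> controls derivatives in fixed directions only, whereas in the chain
  rule the direction fed to the derivative of g moves with x. Expanding it in \<open>Basis\<close>
  leaves partial derivatives of g composed with f, to which the induction applies, with moving
  coefficients in front.\<close>

lemma Ck_on_compose:
  fixes f :: "'a::euclidean_space \<Rightarrow> 'b::euclidean_space" and g :: "'b \<Rightarrow> real"
  assumes "open S" "Ck_on k T g" "Ck_on k S f" "f ` S \<subseteq> T"
  shows "Ck_on k S (\<lambda>x. g (f x))"
  using assms(2,3)
proof (induction k arbitrary: g)
  case 0
  then show ?case using continuous_on_compose2 assms(4) by (metis Ck_on.simps(1))
next
  case (Suc k)
  have T: "f x \<in> T" if "x \<in> S" for x using that assms(4) by auto
  have der: "((\<lambda>x. g (f x)) has_derivative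
      (\<lambda>v. \<Sum>i\<in>Basis. (frechet_derivative f (at x) v \<bullet> i) * frechet_derivative g (at (f x)) i)) (at x)"
    if "x \<in> S" for x
  proof -
    have g: "(g has_derivative frechet_derivative g (at (f x))) (at (f x))"
      by (rule Ck_on_SucD(1)[OF Suc.prems(1) T[OF that]])
    have "((\<lambda>x. g (f x)) has_derivative 
        (\<lambda>v. frechet_derivative g (at (f x)) (frechet_derivative f (at x) v))) (at x)"
      by (rule has_derivative_compose[OF Ck_on_SucD(1)[OF Suc.prems(2) that] g])
    then show ?thesis
      by (subst (asm) linear_euclidean_sum[OF has_derivative_linear[OF g]]) simp
  qed
  show ?case
    by (rule Ck_on_SucI[OF \<open>open S\<close> der])
       (auto intro!: Ck_on_sum Ck_on_mult \<open>open S\<close> Suc.IH[OF Ck_on_SucD(2)[OF Suc.prems(1)]] Ck_on_less[OF Suc.prems(2)]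
          Ck_on_bounded_linear[OF \<open>open S\<close> bounded_linear_inner_left] Ck_on_SucD(2)[OF Suc.prems(2)])
qed

section \<open>Smoothness of all orders\<close>

lemma smooth_on_cong:
  "smooth_on S f \<Longrightarrow> open S \<Longrightarrow> (\<And>x. x \<in> S \<Longrightarrow> f x = g x) \<Longrightarrow> smooth_on S g"
  unfolding smooth_on_def using Ck_on_cong by blast

lemma smooth_on_subset: "smooth_on T f \<Longrightarrow> S \<subseteq> T \<Longrightarrow> smooth_on S f"
  unfolding smooth_on_def using Ck_on_subset by blast

lemma smooth_on_const: "smooth_on S (\<lambda>x. c)"
  unfolding smooth_on_def using Ck_on_const by blast

lemma smooth_on_continuous: "smooth_on S f \<Longrightarrow> continuous_on S f"
  unfolding smooth_on_def using Ck_on_continuous by blast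

lemma smooth_on_local:
  assumes "\<And>x. x \<in> S \<Longrightarrow> \<exists>T. open T \<and> x \<in> T \<and> smooth_on T f"
  shows "smooth_on S f"
  unfolding smooth_on_def
proof
  fix k
  have "Ck_on k (\<Union>{T. open T \<and> smooth_on T f}) f"
    by (rule Ck_on_Union) (auto simp: smooth_on_def)
  then show "Ck_on k S f"
    by (rule Ck_on_subset) (use assms in blast)
qed

lemma smooth_on_inner: "open S \<Longrightarrow> smooth_on S f \<Longrightarrow> smooth_on S (\<lambda>x. f x \<bullet> i)"
  unfolding smooth_on_def using Ck_on_bounded_linear[OF _ bounded_linear_inner_left] by blast

lemma smooth_on_ident: "open S \<Longrightarrow> smooth_on S (\<lambda>x. x)"
  unfolding smooth_on_def using Ck_on_ident by blast

lemma smooth_on_add: "open S \<Longrightarrow> smooth_on S f \<Longrightarrow> smooth_on S g \<Longrightarrow> smooth_on S (\<lambda>x. f x + g x)"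
  unfolding smooth_on_def using Ck_on_add by blast

lemma smooth_on_sum:
  "open S \<Longrightarrow> (\<And>i. i \<in> I \<Longrightarrow> smooth_on S (f i)) \<Longrightarrow> smooth_on S (\<lambda>x. \<Sum>i\<in>I. f i x)"
  unfolding smooth_on_def using Ck_on_sum[of S I] by blast

lemma smooth_on_mult:
  fixes f g :: "'a::euclidean_space \<Rightarrow> real"
  shows "open S \<Longrightarrow> smooth_on S f \<Longrightarrow> smooth_on S g \<Longrightarrow> smooth_on S (\<lambda>x. f x * g x)"
  unfolding smooth_on_def using Ck_on_mult by blast

lemma smooth_on_inverse:
  fixes f :: "'a::euclidean_space \<Rightarrow> real"
  shows "open S \<Longrightarrow> smooth_on S f \<Longrightarrow> (\<And>x. x \<in> S \<Longrightarrow> f x \<noteq> 0) \<Longrightarrow> smooth_on S (\<lambda>x. inverse (f x))"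
  unfolding smooth_on_def using Ck_on_inverse by blast

lemma smooth_on_compose:
  fixes f :: "'a::euclidean_space \<Rightarrow> 'b::euclidean_space" and g :: "'b \<Rightarrow> real"
  shows "open S \<Longrightarrow> smooth_on T g \<Longrightarrow> smooth_on S f \<Longrightarrow> f ` S \<subseteq> T \<Longrightarrow> smooth_on S (\<lambda>x. g (f x))"
  unfolding smooth_on_def using Ck_on_compose by blast

lemma smooth_on_frechet_derivative:
  "smooth_on S f \<Longrightarrow> smooth_on S (\<lambda>x. frechet_derivative f (at x) v)"
  unfolding smooth_on_def using Ck_on_SucD(2) by blast

lemma smooth_on_has_derivative:
  "smooth_on S f \<Longrightarrow> x \<in> S \<Longrightarrow> (f has_derivative frechet_derivative f (at x)) (at x)"
  unfolding smooth_on_def using Ck_on_SucD(1) by blast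


section \<open>Smooth bump functions\<close>

text \<open>The classical exp(-1/t), extended by 0, times powers of 1/t. The powers make the span of
  the family closed under differentiation, so smoothness can be proved for all n at once.\<close>

definition flat :: "nat \<Rightarrow> real \<Rightarrow> real" where
  "flat n t = (if t > 0 then inverse t ^ n * exp (- inverse t) else 0)"

lemma flat_tendsto_0: "(flat n \<longlongrightarrow> 0) (at 0)"
proof -
  have "((\<lambda>t. inverse t ^ n / exp (inverse t)) \<longlongrightarrow> 0) (at_right (0::real))"
    by (rule filterlim_compose[OF tendsto_power_div_exp_0 filterlim_inverse_at_top_right])
  then have "(flat n \<longlongrightarrow> 0) (at_right 0)"
    by (rule Lim_transform_eventually)
       (auto simp: flat_def exp_minus field_simps eventually_at_filter)
  moreover have "(flat n \<longlongrightarrow> 0) (at_left 0)"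
    by (rule Lim_transform_eventually[OF tendsto_const])
       (auto simp: flat_def eventually_at_filter)
  ultimately show ?thesis
    by (simp add: filterlim_split_at)
qed

text \<open>The delicate point is 0, where the difference quotient of \<open>flat n\<close> is
  \<open>flat (n + 1)\<close> and hence tends to 0.\<close>

lemma flat_has_derivative:
  "(flat n has_real_derivative flat (n + 2) t - n * flat (n + 1) t) (at t)"
proof (cases t "0::real" rule: linorder_cases)
  case less
  have "((\<lambda>_. 0) has_real_derivative flat (n + 2) t - n * flat (n + 1) t) (at t)"
    using less by (auto simp: flat_def intro!: derivative_eq_intros)
  then show ?thesis
    by (rule has_field_derivative_transform_within_open[where S = "{..<0}"])
       (use less in \<open>auto simp: flat_def\<close>)
next
  case equal
  have "((\<lambda>h. flat n h / h) \<longlongrightarrow> 0) (at 0)"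
    by (rule Lim_transform_eventually[OF flat_tendsto_0[of "n + 1"]])
       (auto simp: flat_def divide_inverse eventually_at_filter)
  then show ?thesis
    unfolding equal DERIV_def by (simp add: flat_def)
next
  case greater
  have "((\<lambda>t. inverse t ^ n * exp (- inverse t)) has_real_derivative 
     flat (n + 2) t - n * flat (n + 1) t) (at t)"
    using greater
    by (auto intro!: derivative_eq_intros simp: flat_def)
       (cases n; auto simp: algebra_simps power2_eq_square)
  then show ?thesis
    by (rule has_field_derivative_transform_within_open[where S = "{0<..}"])
       (use greater in \<open>auto simp: flat_def\<close>)
qed

lemma Ck_on_flat: "Ck_on k UNIV (flat n)"
proof (induction k arbitrary: n)
  case 0
  then show ?case
    using flat_has_derivative DERIV_isCont continuous_at_imp_continuous_on by (metis Ck_on.simps(1))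
next
  case (Suc k)
  have c: "Ck_on k UNIV (\<lambda>t. c * flat m t)" for c m
    by (rule Ck_on_mult[OF open_UNIV Ck_on_const Suc.IH])
  have "Ck_on k UNIV (\<lambda>t. v * (1 * flat (n + 2) t + (- n) * flat (n + 1) t))" for v
    by (intro Ck_on_mult[OF open_UNIV Ck_on_const] Ck_on_add[OF open_UNIV] c)
  then have "Ck_on k UNIV (\<lambda>t. (flat (n + 2) t - n * flat (n + 1) t) * v)" for v
    by (simp add: mult.commute)
  then show ?case
    by (rule Ck_on_SucI[OF open_UNIV flat_has_derivative[unfolded has_field_derivative_def]])
qed

text \<open>The witness is u / (u + w) with u positive where the squared distance d is below
  \<open>4 * r\<^sup>2\<close> and w positive where d is above \<open>r\<^sup>2\<close>. One of the
  two always holds, so the denominator never vanishes; w is 0 on the small ball and u is 0 outside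
  the large one. The squared distance is used because it is smooth at the centre too.\<close>

lemma smooth_bump:
  fixes a :: "'a::euclidean_space"
  assumes "r > 0"
  obtains b :: "'a \<Rightarrow> real" where "smooth_on UNIV b" 
    "\<And>x. x \<in> cball a r \<Longrightarrow> b x = 1" "\<And>x. x \<notin> cball a (2 * r) \<Longrightarrow> b x = 0"
proof -
  define d where "d x = (x - a) \<bullet> (x - a)" for x
  have lin: "smooth_on UNIV (\<lambda>x. (x + - a) \<bullet> i)" for i
    by (intro smooth_on_inner smooth_on_add smooth_on_ident smooth_on_const open_UNIV)
  have "smooth_on UNIV (\<lambda>x. \<Sum>i\<in>Basis. ((x + - a) \<bullet> i) * ((x + - a) \<bullet> i))"
    by (intro smooth_on_sum smooth_on_mult lin open_UNIV)
  then have d: "smooth_on UNIV d"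
    by (rule smooth_on_cong[OF _ open_UNIV]) (subst d_def, subst euclidean_inner, simp)
  have flat: "smooth_on UNIV (flat 0)"
    using Ck_on_flat by (simp add: smooth_on_def)
  have "smooth_on UNIV (\<lambda>x. 4 * r\<^sup>2 + -1 * d x)" "smooth_on UNIV (\<lambda>x. d x + - r\<^sup>2)"
    by (intro smooth_on_add smooth_on_mult smooth_on_const d open_UNIV)+
  then have f1: "smooth_on UNIV (\<lambda>x. flat 0 (4 * r\<^sup>2 + -1 * d x))"
    and f2: "smooth_on UNIV (\<lambda>x. flat 0 (d x + - r\<^sup>2))"
    using smooth_on_compose[OF open_UNIV flat] by (metis subset_UNIV)+
  let ?s = "\<lambda>x. flat 0 (4 * r\<^sup>2 + -1 * d x) + flat 0 (d x + - r\<^sup>2)"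
  have pos: "?s x \<noteq> 0" for x
  proof -
    have "4 * r\<^sup>2 + -1 * d x > 0 \<or> d x + - r\<^sup>2 > 0"
      using zero_less_power[OF assms, of 2] by linarith
    then show ?thesis
      by (auto simp: flat_def add_pos_pos less_imp_neq[THEN not_sym])
  qed
  have d_eq: "d x = (dist a x)\<^sup>2" for x
    by (metis d_def dist_commute dist_norm power2_norm_eq_inner)
  show thesis
  proof (rule that)
    show "smooth_on UNIV (\<lambda>x. flat 0 (4 * r\<^sup>2 + -1 * d x) * inverse (?s x))"
      by (intro smooth_on_mult smooth_on_inverse smooth_on_add f1 f2 open_UNIV pos)
    show "flat 0 (4 * r\<^sup>2 + -1 * d x) * inverse (?s x) = 1" if "x \<in> cball a r" for x
    proof -
      have "flat 0 (d x + - r\<^sup>2) = 0"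
        using that power_mono[of "dist a x" r 2] by (auto simp: flat_def d_eq)
      then show ?thesis using pos[of x] by simp
    qed
    show "flat 0 (4 * r\<^sup>2 + -1 * d x) * inverse (?s x) = 0" if "x \<notin> cball a (2 * r)" for x
    proof -
      have "(2 * r)\<^sup>2 \<le> (dist a x)\<^sup>2"
        using that assms by (intro power_mono) auto
      then show ?thesis by (simp add: flat_def d_eq power_mult_distrib)
    qed
  qed
qed

section \<open>Averages along rays and Hadamard's lemma\<close>

text \<open>Differentiating in z under the integral produces one more factor t. Carrying the weight
  \<open>t ^ m\<close> makes the statement stable under this step, with m raised by one.\<close>

lemma Ck_on_ray_integral:
  fixes f :: "'a::euclidean_space \<Rightarrow> real"
  assumes "Ck_on k (ball a r) f"
  shows "Ck_on k (ball a r) (\<lambda>z. integral {0..1} (\<lambda>t. t ^ m * f (a + t *\<^sub>R (z - a))))"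
  using assms
proof (induction k arbitrary: f m)
  have ray: "a + t *\<^sub>R (z - a) \<in> ball a r" if "z \<in> ball a r" "t \<in> {0..1}" for z t
  proof -
    have "t * norm (z - a) \<le> 1 * norm (z - a)"
      using that by (intro mult_right_mono) auto
    then show ?thesis
      using that by (auto simp: dist_norm norm_minus_commute)
  qed
  have cont: "continuous_on (ball a r \<times> {0..1}) (\<lambda>(z, t). t ^ m * f (a + t *\<^sub>R (z - a)))"
    if "continuous_on (ball a r) f" for m and f :: "'a \<Rightarrow> real"
  proof -
    have "continuous_on (ball a r \<times> {0..1}) (\<lambda>p. f (a + snd p *\<^sub>R (fst p - a)))"
      by (rule continuous_on_compose2[OF that]) (auto intro!: continuous_intros simp del: mem_ball intro: ray)
    then show ?thesis
      unfolding split_beta by (auto intro!: continuous_intros)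
  qed
  have cont1: "continuous_on {0..1} (\<lambda>t. t ^ m * f (a + t *\<^sub>R (z - a)))"
    if "continuous_on (ball a r) f" "z \<in> ball a r" for m z and f :: "'a \<Rightarrow> real"
    by (rule continuous_on_compose2[OF cont[OF that(1), of m], where f = "\<lambda>t. (z, t)", unfolded split])
       (use that in \<open>auto intro!: continuous_intros\<close>)
  {
    case 0
    then show ?case
      using integral_continuous_on_param[of "ball a r" 0 1 "\<lambda>z t. t ^ m * f (a + t *\<^sub>R (z - a))"] cont
      by simp
  next
    case (Suc k)
    have lin: "bounded_linear (\<lambda>v. t ^ m * frechet_derivative f (at (a + t *\<^sub>R (z - a))) (t *\<^sub>R v))"
      if "z \<in> ball a r" "t \<in> {0..1}" for z t
      by (intro bounded_linear_const_mult bounded_linear_compose[OF has_derivative_bounded_linear[OF 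
            Ck_on_SucD(1)[OF Suc.prems ray[OF that]]] bounded_linear_scaleR_right])
    \<comment> \<open>\<open>leibniz_rule\<close> wants the derivative in z as a bounded linear
      function that depends continuously on (z, t); in finite dimension this continuity can be
      checked on single vectors.\<close>
    define D where 
      "D z t = Blinfun (\<lambda>v. t ^ m * frechet_derivative f (at (a + t *\<^sub>R (z - a))) (t *\<^sub>R v))" for z t
    have D: "blinfun_apply (D z t) v = t ^ Suc m * frechet_derivative f (at (a + t *\<^sub>R (z - a))) v"
      if "z \<in> ball a r" "t \<in> {0..1}" for z t v
    proof -
      have "blinfun_apply (D z t) v = t ^ m * frechet_derivative f (at (a + t *\<^sub>R (z - a))) (t *\<^sub>R v)"
        unfolding D_def by (simp only: bounded_linear_Blinfun_apply[OF lin[OF that]])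
      then show ?thesis
        using linear_scale[OF has_derivative_linear[OF Ck_on_SucD(1)[OF Suc.prems ray[OF that]]], of t v]
        by simp
    qed
    have contD: "continuous_on (ball a r \<times> {0..1}) (\<lambda>(z, t). D z t)"
    proof (rule continuous_on_blinfun_componentwise)
      fix i :: 'a
      show "continuous_on (ball a r \<times> {0..1}) (\<lambda>x. blinfun_apply (case x of (z, t) \<Rightarrow> D z t) i)"
        by (rule continuous_on_eq[OF cont[OF Ck_on_continuous[OF Ck_on_SucD(2)[OF Suc.prems]], of "Suc m" i]])
           (use D in auto)
    qed
    let ?I = "\<lambda>z. integral {0..1} (\<lambda>t. t ^ m * f (a + t *\<^sub>R (z - a)))"
    have der: "(?I has_derivative blinfun_apply (integral {0..1} (D z))) (at z)" if z: "z \<in> ball a r" for z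
    proof -
      have "(?I has_derivative blinfun_apply (integral (cbox 0 1) (D z))) (at z within ball a r)"
        unfolding cbox_interval[symmetric]
      proof (rule leibniz_rule[OF _ _ _ z convex_ball])
        fix z t assume z: "z \<in> ball a r" and t: "t \<in> cbox 0 (1::real)"
        then have ray: "a + t *\<^sub>R (z - a) \<in> ball a r" by (intro ray) auto
        have "((\<lambda>z. a + t *\<^sub>R (z - a)) has_derivative (\<lambda>v. t *\<^sub>R v)) (at z)"
          by (auto intro!: derivative_eq_intros)
        from has_derivative_compose[OF this Ck_on_SucD(1)[OF Suc.prems ray]]
        have "((\<lambda>z. f (a + t *\<^sub>R (z - a))) has_derivative
            (\<lambda>v. frechet_derivative f (at (a + t *\<^sub>R (z - a))) (t *\<^sub>R v))) (at z)" .
        then show "((\<lambda>z. t ^ m * f (a + t *\<^sub>R (z - a))) has_derivative blinfun_apply (D z t)) (at z within ball a r)"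
          unfolding D_def using z t
          by (subst bounded_linear_Blinfun_apply[OF lin])
             (auto intro!: has_derivative_at_withinI has_derivative_mult_right)
      next
        fix z assume "z \<in> ball a r"
        then show "(\<lambda>t. t ^ m * f (a + t *\<^sub>R (z - a))) integrable_on cbox 0 1"
          using cont1[OF Ck_on_continuous[OF Suc.prems]] by (intro integrable_continuous) auto
      qed (use contD in simp)
      then show ?thesis
        using z by (simp add: at_within_open[OF z])
    qed
    show ?case
    proof (rule Ck_on_SucI[OF open_ball der])
      fix v
      have "integral {0..1} (\<lambda>t. t ^ Suc m * frechet_derivative f (at (a + t *\<^sub>R (z - a))) v) =
          blinfun_apply (integral {0..1} (D z)) v" if z: "z \<in> ball a r" for z
      proof -
        have "continuous_on {0..1} (D z)"
          by (rule continuous_on_compose2[OF contD, where f = "\<lambda>t. (z, t)", unfolded split])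
             (use z in \<open>auto intro!: continuous_intros\<close>)
        then have "D z integrable_on {0..1}"
          by (rule integrable_continuous_real)
        then show ?thesis
          unfolding blinfun_apply_integral[OF \<open>D z integrable_on {0..1}\<close>]
          by (intro integral_cong D[OF z, symmetric])
      qed
      then show "Ck_on k (ball a r) (\<lambda>z. blinfun_apply (integral {0..1} (D z)) v)"
        by (rule Ck_on_cong[OF open_ball Suc.IH[OF Ck_on_SucD(2)[OF Suc.prems]]])
    qed
  }
qed

text \<open>Hadamard's lemma: the functions \<open>h i\<close> are the averages of the partial derivatives over the
  segment from \<open>a\<close> to \<open>z\<close>.\<close>

lemma smooth_on_ball_expand:
  fixes f :: "'a::euclidean_space \<Rightarrow> real"
  assumes f: "smooth_on (ball a r) f"
  obtains h where "\<And>i. smooth_on (ball a r) (h i)"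
    "\<And>z. z \<in> ball a r \<Longrightarrow> f z = f a + (\<Sum>i\<in>Basis. ((z - a) \<bullet> i) * h i z)"
    "\<And>i. h i a = frechet_derivative f (at a) i"
proof -
  define h where "h i z = integral {0..1} (\<lambda>t. frechet_derivative f (at (a + t *\<^sub>R (z - a))) i)" for i z
  have df: "smooth_on (ball a r) (\<lambda>z. frechet_derivative f (at z) i)" for i
    by (rule smooth_on_frechet_derivative[OF f])
  show thesis
  proof (rule that)
    show "smooth_on (ball a r) (h i)" for i
      using Ck_on_ray_integral[of _ a r "\<lambda>z. frechet_derivative f (at z) i" 0] df
      by (simp add: h_def[abs_def] smooth_on_def)
    show "h i a = frechet_derivative f (at a) i" for i
      by (simp add: h_def)
    fix z assume z: "z \<in> ball a r"
    have ray: "a + t *\<^sub>R (z - a) \<in> ball a r" if "t \<in> {0..1}" for t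
    proof -
      have "t * norm (z - a) \<le> 1 * norm (z - a)"
        using that by (intro mult_right_mono) auto
      then show ?thesis
        using that z by (auto simp: dist_norm norm_minus_commute)
    qed
    have int: "(\<lambda>t. frechet_derivative f (at (a + t *\<^sub>R (z - a))) i) integrable_on {0..1}" for i
      by (rule integrable_continuous_real, rule continuous_on_compose2[OF smooth_on_continuous[OF df]])
         (auto intro!: continuous_intros simp del: mem_ball intro: ray)
    \<comment> \<open>The fundamental theorem of calculus along the ray; the direction z - a is
      afterwards split along \<open>Basis\<close>.\<close>
    have "((\<lambda>t. frechet_derivative f (at (a + t *\<^sub>R (z - a))) (z - a)) has_integral 
        f (a + 1 *\<^sub>R (z - a)) - f (a + 0 *\<^sub>R (z - a))) {0..1}"
    proof (rule fundamental_theorem_of_calculus)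
      fix t :: real assume t: "t \<in> {0..1}"
      note der = smooth_on_has_derivative[OF f ray[OF t]]
      have "((\<lambda>t. a + t *\<^sub>R (z - a)) has_derivative (\<lambda>s. s *\<^sub>R (z - a))) (at t)"
        by (auto intro!: derivative_eq_intros)
      from has_derivative_compose[OF this der]
      have "((\<lambda>t. f (a + t *\<^sub>R (z - a))) has_derivative
          (\<lambda>s. frechet_derivative f (at (a + t *\<^sub>R (z - a))) (s *\<^sub>R (z - a)))) (at t)" .
      then show "((\<lambda>t. f (a + t *\<^sub>R (z - a))) has_vector_derivative
          frechet_derivative f (at (a + t *\<^sub>R (z - a))) (z - a)) (at t within {0..1})"
        using linear_scale[OF has_derivative_linear[OF der]]
        by (simp add: has_vector_derivative_def has_derivative_at_withinI)
    qed simp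
    moreover have "((\<lambda>t. frechet_derivative f (at (a + t *\<^sub>R (z - a))) (z - a)) has_integral 
        (\<Sum>i\<in>Basis. ((z - a) \<bullet> i) * h i z)) {0..1}"
    proof (rule has_integral_eq)
      show "((\<lambda>t. \<Sum>i\<in>Basis. ((z - a) \<bullet> i) * frechet_derivative f (at (a + t *\<^sub>R (z - a))) i) has_integral 
        (\<Sum>i\<in>Basis. ((z - a) \<bullet> i) * h i z)) {0..1}"
        unfolding h_def
        by (intro has_integral_sum has_integral_mult_right integrable_integral int) auto
      fix t :: real assume t: "t \<in> {0..1}"
      show "(\<Sum>i\<in>Basis. ((z - a) \<bullet> i) * frechet_derivative f (at (a + t *\<^sub>R (z - a))) i) =
        frechet_derivative f (at (a + t *\<^sub>R (z - a))) (z - a)"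
        by (subst (2) linear_euclidean_sum[OF has_derivative_linear[OF smooth_on_has_derivative[OF f ray[OF t]]]])
           simp
    qed
    ultimately have "f (a + 1 *\<^sub>R (z - a)) - f (a + 0 *\<^sub>R (z - a)) = (\<Sum>i\<in>Basis. ((z - a) \<bullet> i) * h i z)"
      by (rule has_integral_unique)
    then show "f z = f a + (\<Sum>i\<in>Basis. ((z - a) \<bullet> i) * h i z)"
      by simp
  qed
qed

section \<open>Smooth functions on manifolds\<close>


lemma sum_fun_apply: "(\<Sum>i\<in>I. f i) x = (\<Sum>i\<in>I. f i x)"
  by (induction I rule: infinite_finite_induct) auto

locale manifold =
  fixes A :: "('m::{t2_space,second_countable_topology}, 'e::euclidean_space) atlas"
  assumes smooth_manifold: "smooth_manifold A"
begin

lemma chart: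
  assumes "(U, x) \<in> A"
  shows "open U" "open (x ` U)" "continuous_on U x" "continuous_on (x ` U) (inv_into U x)"
    "q \<in> U \<Longrightarrow> inv_into U x (x q) = q"
  using smooth_manifold assms homeomorphism_apply1[of U "x ` U" x "inv_into U x" q]
  by (auto simp: smooth_manifold_def homeomorphism_def)

lemma chart_at: obtains U x where "(U, x) \<in> A" "p \<in> U"
  using smooth_manifold unfolding smooth_manifold_def by blast

lemma open_chart_image:
  assumes "(U, x) \<in> A" "open W" "W \<subseteq> U"
  shows "open (x ` W)"
proof -
  have "x ` W = x ` U \<inter> inv_into U x -` W"
    using assms chart(5)[OF assms(1)] by fastforce
  then show ?thesis
    using continuous_open_preimage[OF chart(4,2)[OF assms(1)] assms(2)] by simp
qed

lemma open_chart_preimage: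
  assumes "(U, x) \<in> A" "open T"
  shows "open (U \<inter> x -` T)"
  by (rule continuous_open_preimage[OF chart(3,1)[OF assms(1)] assms(2)])

lemma smooth_transition:
  assumes "(U, x) \<in> A" "(V, y) \<in> A"
  shows "smooth_on (x ` (U \<inter> V)) (\<lambda>z. y (inv_into U x z))"
  using smooth_manifold assms by (force simp: smooth_manifold_def o_def)

lemma smooth_funD:
  assumes "smooth_fun A f" "(U, x) \<in> A" "W \<subseteq> U"
  shows "smooth_on (x ` W) (\<lambda>z. f (inv_into U x z))"
  using assms smooth_on_subset[of "x ` U" _ "x ` W"] by (force simp: smooth_fun_def o_def)

text \<open>One chart around each point suffices, because the transition maps carry smoothness over
  to every other chart.\<close>

lemma smooth_funI:
  assumes "\<And>p. \<exists>U x W. (U, x) \<in> A \<and> p \<in> W \<and> open W \<and> W \<subseteq> U \<and> smooth_on (x ` W) (\<lambda>z. f (inv_into U x z))"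
  shows "smooth_fun A f"
  unfolding smooth_fun_def
proof safe
  fix V y assume V: "(V, y) \<in> A"
  show "smooth_on (y ` V) (f \<circ> inv_into V y)"
  proof (rule smooth_on_local)
    fix z assume "z \<in> y ` V"
    then obtain p where p: "p \<in> V" "z = y p" by auto
    obtain U x W where U: "(U, x) \<in> A" "p \<in> W" "open W" "W \<subseteq> U"
      and sm: "smooth_on (x ` W) (\<lambda>z. f (inv_into U x z))"
      using assms by blast
    have "open (y ` (W \<inter> V))"
      using U chart(1)[OF V] by (intro open_chart_image[OF V]) auto
    moreover have "smooth_on (y ` (W \<inter> V)) (f \<circ> inv_into V y)"
    proof (rule smooth_on_cong[OF smooth_on_compose[OF _ sm]])
      show "smooth_on (y ` (W \<inter> V)) (\<lambda>z. x (inv_into V y z))"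
        by (rule smooth_on_subset[OF smooth_transition[OF V U(1)]]) (use U in auto)
    qed (use calculation U V chart(5) in auto)
    ultimately show "\<exists>T. open T \<and> z \<in> T \<and> smooth_on T (f \<circ> inv_into V y)"
      using p U by auto
  qed
qed

lemma smooth_fun_eventually:
  assumes "\<And>p. \<exists>h. smooth_fun A h \<and> (\<forall>\<^sub>F q in nhds p. f q = h q)"
  shows "smooth_fun A f"
proof (rule smooth_funI)
  fix p
  obtain h S where h: "smooth_fun A h" and S: "open S" "p \<in> S" "\<And>q. q \<in> S \<Longrightarrow> f q = h q"
    using assms[of p] by (auto simp: eventually_nhds)
  obtain U x where U: "(U, x) \<in> A" "p \<in> U" by (rule chart_at)
  have "open (S \<inter> U)" using S chart(1)[OF U(1)] by auto
  moreover have "smooth_on (x ` (S \<inter> U)) (\<lambda>z. f (inv_into U x z))"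
    by (rule smooth_on_cong[OF smooth_funD[OF h U(1)]])
       (use open_chart_image[OF U(1) calculation] S chart(5)[OF U(1)] in auto)
  ultimately show "\<exists>U x W. (U, x) \<in> A \<and> p \<in> W \<and> open W \<and> W \<subseteq> U \<and> smooth_on (x ` W) (\<lambda>z. f (inv_into U x z))"
    using U S by blast
qed

lemma smooth_fun_const: "smooth_fun A (\<lambda>q. c)"
  by (auto simp: smooth_fun_def o_def intro: smooth_on_const)

lemma smooth_fun_add: "smooth_fun A f \<Longrightarrow> smooth_fun A h \<Longrightarrow> smooth_fun A (\<lambda>q. f q + h q)"
  using chart(2) by (fastforce simp: smooth_fun_def o_def intro: smooth_on_add)

lemma smooth_fun_mult: "smooth_fun A f \<Longrightarrow> smooth_fun A h \<Longrightarrow> smooth_fun A (\<lambda>q. f q * h q)"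
  using chart(2) by (fastforce simp: smooth_fun_def o_def intro: smooth_on_mult)

lemma smooth_fun_diff: "smooth_fun A f \<Longrightarrow> smooth_fun A h \<Longrightarrow> smooth_fun A (\<lambda>q. f q - h q)"
  using smooth_fun_add[of f "\<lambda>q. (- 1) * h q"] smooth_fun_mult[OF smooth_fun_const, of h "-1"] by simp

lemma smooth_fun_sum: "(\<And>i. i \<in> I \<Longrightarrow> smooth_fun A (f i)) \<Longrightarrow> smooth_fun A (\<lambda>q. \<Sum>i\<in>I. f i q)"
  by (induction I rule: infinite_finite_induct) (auto intro: smooth_fun_const smooth_fun_add)

text \<open>Multiplication by a bump function turns functions of the coordinates into global ones.
  The set K outside which F vanishes is exposed because callers need to know where F is 0 or to
  extend other objects by zero.\<close>

lemma smooth_fun_extend: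
  assumes U: "(U, x) \<in> A" and W: "p \<in> W" "open W" "W \<subseteq> U" and h: "smooth_on (x ` W) h"
  obtains F K where "smooth_fun A F" "closed K" "K \<subseteq> W" "\<And>q. q \<notin> K \<Longrightarrow> F q = 0"
    "\<forall>\<^sub>F q in nhds p. F q = h (x q)"
proof -
  have opW: "open (x ` W)" by (rule open_chart_image[OF U W(2,3)])
  then obtain r where r: "r > 0" "cball (x p) r \<subseteq> x ` W"
    using W(1) open_contains_cball by blast
  \<comment> \<open>With half the radius, the bump function vanishes off the ball of radius r, which
    lies in the image of W.\<close>
  obtain b :: "'e \<Rightarrow> real" where b: "smooth_on UNIV b" "\<And>z. z \<in> cball (x p) (r / 2) \<Longrightarrow> b z = 1"
    "\<And>z. z \<notin> cball (x p) (2 * (r / 2)) \<Longrightarrow> b z = 0"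
    by (rule smooth_bump[of "r / 2" "x p"]) (use r in auto)
  define K where "K = inv_into U x ` cball (x p) r"
  have "continuous_on (cball (x p) r) (inv_into U x)"
    by (rule continuous_on_subset[OF chart(4)[OF U]]) (use r W in auto)
  then have "compact K"
    unfolding K_def by (rule compact_continuous_image) simp
  \<comment> \<open>A compact set is closed as the manifold is Hausdorff; hence F vanishes near
    every point outside W.\<close>
  then have K: "closed K" by (rule compact_imp_closed)
  have KW: "K \<subseteq> W"
  proof
    fix q assume "q \<in> K"
    then obtain q' where "q' \<in> W" "q = inv_into U x (x q')" using r by (auto simp: K_def)
    then show "q \<in> W" using chart(5)[OF U] W(3) by auto
  qed
  define F where "F q = (if q \<in> W then b (x q) * h (x q) else 0)" for q
  have F0: "F q = 0" if "q \<notin> K" for q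
  proof (cases "q \<in> W")
    case True
    then have "x q \<notin> cball (x p) (2 * (r / 2))"
      using that chart(5)[OF U, of q] W(3) by (force simp: K_def)
    then have "b (x q) = 0" by (rule b(3))
    then show ?thesis by (simp add: F_def)
  qed (simp add: F_def)
  have "smooth_fun A F"
  proof (rule smooth_funI)
    fix q
    show "\<exists>U x W. (U, x) \<in> A \<and> q \<in> W \<and> open W \<and> W \<subseteq> U \<and> smooth_on (x ` W) (\<lambda>z. F (inv_into U x z))"
    proof (cases "q \<in> W")
      case True
      have "smooth_on (x ` W) (\<lambda>z. b z * h z)"
        by (rule smooth_on_mult[OF opW smooth_on_subset[OF b(1)] h]) simp
      then have "smooth_on (x ` W) (\<lambda>z. F (inv_into U x z))"
        by (rule smooth_on_cong[OF _ opW]) (use W(3) chart(5)[OF U] in \<open>auto simp: F_def\<close>)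
      then show ?thesis using U W True by blast
    next
      case False
      obtain V y where V: "(V, y) \<in> A" "q \<in> V" by (rule chart_at)
      have op: "open (V - K)" using K chart(1)[OF V(1)] by auto
      have "smooth_on (y ` (V - K)) (\<lambda>z. F (inv_into V y z))"
        by (rule smooth_on_cong[OF smooth_on_const[of _ 0] open_chart_image[OF V(1) op]])
           (use F0 chart(5)[OF V(1)] in auto)
      then show ?thesis using V op False KW by blast
    qed
  qed
  moreover have "\<forall>\<^sub>F q in nhds p. F q = h (x q)"
    unfolding eventually_nhds
  proof (intro exI conjI ballI)
    show "open (W \<inter> (U \<inter> x -` ball (x p) (r / 2)))"
      by (intro open_Int W open_chart_preimage[OF U] open_ball)
    show "p \<in> W \<inter> (U \<inter> x -` ball (x p) (r / 2))" using W r by auto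
    fix q assume "q \<in> W \<inter> (U \<inter> x -` ball (x p) (r / 2))"
    then show "F q = h (x q)" using b(2)[of "x q"] by (auto simp: F_def)
  qed
  ultimately show thesis using that K KW F0 by blast
qed

lemma smooth_fun_isCont:
  assumes "smooth_fun A f"
  shows "isCont f p"
proof -
  obtain U x where U: "(U, x) \<in> A" "p \<in> U" by (rule chart_at)
  have "continuous_on U (\<lambda>q. f (inv_into U x (x q)))"
    by (rule continuous_on_compose2[OF smooth_on_continuous[OF smooth_funD[OF assms U(1)]] chart(3)[OF U(1)]]) auto
  then have "continuous_on U f"
    by (rule continuous_on_eq) (use chart(5)[OF U(1)] in auto)
  then show ?thesis
    using chart(1)[OF U(1)] U(2) continuous_on_eq_continuous_at by blast
qed

section \<open>Linear systems with smooth coefficients\<close>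

text \<open>As f may vanish away from p, its reciprocal is extended from a neighbourhood of p. This
  supplies the division by pivots in the elimination that follows.\<close>

lemma smooth_fun_local_inverse:
  assumes f: "smooth_fun A f" and "f p \<noteq> 0"
  obtains h where "smooth_fun A h" "\<forall>\<^sub>F q in nhds p. f q * h q = 1"
proof -
  obtain U x where U: "(U, x) \<in> A" "p \<in> U" by (rule chart_at)
  have "\<forall>\<^sub>F q in nhds p. f q \<noteq> 0"
    using smooth_fun_isCont[OF f, of p] assms(2)
    by (simp add: continuous_within tendsto_imp_eventually_ne eventually_nhds_conv_at)
  then obtain S where S: "open S" "p \<in> S" "\<And>q. q \<in> S \<Longrightarrow> f q \<noteq> 0"
    by (auto simp: eventually_nhds)
  have W: "p \<in> S \<inter> U" "open (S \<inter> U)" "S \<inter> U \<subseteq> U"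
    using S U chart(1)[OF U(1)] by auto
  have "smooth_on (x ` (S \<inter> U)) (\<lambda>z. inverse (f (inv_into U x z)))"
    by (rule smooth_on_inverse[OF open_chart_image[OF U(1) W(2,3)] smooth_funD[OF f U(1) W(3)]])
       (use S chart(5)[OF U(1)] in auto)
  then obtain h K where h: "smooth_fun A h" "\<forall>\<^sub>F q in nhds p. h q = inverse (f (inv_into U x (x q)))"
    by (rule smooth_fun_extend[OF U(1) W])
  have "\<forall>\<^sub>F q in nhds p. q \<in> S \<inter> U"
    by (rule eventually_nhds_in_open[OF W(2,1)])
  then have "\<forall>\<^sub>F q in nhds p. f q * h q = 1"
    using h(2) by eventually_elim (use S chart(5)[OF U(1)] in auto)
  then show thesis using that h(1) by blast
qed

text \<open>Gaussian elimination; the pivots are Schur complements, hence positive at \<open>p\<close>.\<close>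

lemma solve_positive_definite:
  assumes "finite I"
    and "\<And>i j. i \<in> I \<Longrightarrow> j \<in> I \<Longrightarrow> smooth_fun A (G i j)" "\<And>i. i \<in> I \<Longrightarrow> smooth_fun A (b i)"
    and "\<And>i j. i \<in> I \<Longrightarrow> j \<in> I \<Longrightarrow> G i j p = G j i p"
    and "\<And>a. \<exists>i\<in>I. a i \<noteq> 0 \<Longrightarrow> (\<Sum>i\<in>I. \<Sum>j\<in>I. a i * a j * G i j p) > (0::real)"
  shows "\<exists>c. (\<forall>i. smooth_fun A (c i)) \<and> (\<forall>\<^sub>F q in nhds p. \<forall>i\<in>I. (\<Sum>j\<in>I. G i j q * c j q) = b i q)"
  using assms
proof (induction I arbitrary: G b rule: finite_induct)
  case empty
  show ?case using smooth_fun_const[of 0] by (intro exI[of _ "\<lambda>_ _. 0"]) simp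
next
  case (insert k I)
  note smG = insert.prems(1) and smb = insert.prems(2) and sym = insert.prems(3) and pos = insert.prems(4)
  have kk: "G k k p > 0"
  proof -
    \<comment> \<open>The indicator of k isolates the pivot in the quadratic form.\<close>
    let ?a = "\<lambda>i. if i = k then 1 else (0::real)"
    have z: "(\<Sum>j\<in>I. f j * ?a j * h j) = 0" "(\<Sum>j\<in>I. ?a j * f j) = 0" for f h
      by (rule sum.neutral; use insert.hyps in auto)+
    have "(\<Sum>i\<in>insert k I. \<Sum>j\<in>insert k I. ?a i * ?a j * G i j p) = G k k p"
      using insert.hyps by (simp add: z sum.distrib sum_distrib_left[symmetric] mult.assoc)
    then show ?thesis using pos[of ?a] by auto
  qed
  then obtain R where R: "smooth_fun A R" "\<forall>\<^sub>F q in nhds p. G k k q * R q = 1"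
    using smooth_fun_local_inverse[of "G k k" p] smG[of k k] by (metis insertI1 less_irrefl)
  have Rp: "G k k p * R p = 1" using R(2) by (rule eventually_nhds_x_imp_x)
  \<comment> \<open>One elimination step: \<open>G'\<close> is the Schur complement of the pivot,
    with R as its local reciprocal, and \<open>b'\<close> is the matching right-hand side.\<close>
  define G' where "G' i j q = G i j q - G i k q * G k j q * R q" for i j q
  define b' where "b' i q = b i q - G i k q * b k q * R q" for i q
  have "\<exists>c. (\<forall>i. smooth_fun A (c i)) \<and> (\<forall>\<^sub>F q in nhds p. \<forall>i\<in>I. (\<Sum>j\<in>I. G' i j q * c j q) = b' i q)"
  proof (rule insert.IH)
    show "smooth_fun A (G' i j)" if "i \<in> I" "j \<in> I" for i j
      unfolding G'_def[abs_def] by (intro smooth_fun_diff smooth_fun_mult smG R) (use that in auto)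
    show "smooth_fun A (b' i)" if "i \<in> I" for i
      unfolding b'_def[abs_def] by (intro smooth_fun_diff smooth_fun_mult smG smb R) (use that in auto)
    show "G' i j p = G' j i p" if "i \<in> I" "j \<in> I" for i j
      using that sym[of i j] sym[of i k] sym[of j k] by (simp add: G'_def)
    fix a :: "'a \<Rightarrow> real" assume a: "\<exists>i\<in>I. a i \<noteq> 0"
    define s where "s = (\<Sum>j\<in>I. a j * G k j p)"
    \<comment> \<open>The value at k minimises the form in that variable, and the minimum is the
      form of the Schur complement at a, which is therefore positive.\<close>
    define a' where "a' i = (if i = k then - (R p * s) else a i)" for i
    have a'I: "a' i = a i" if "i \<in> I" for i using that insert.hyps by (auto simp: a'_def)
    have sk: "(\<Sum>j\<in>I. a' j * G k j p) = s" "(\<Sum>j\<in>I. a' j * G j k p) = s"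
      unfolding s_def by (rule sum.cong; use a'I sym[of _ k] in auto)+
    have "(\<Sum>i\<in>insert k I. \<Sum>j\<in>insert k I. a' i * a' j * G i j p) =
        a' k * a' k * G k k p + a' k * (\<Sum>j\<in>I. a' j * G k j p) + a' k * (\<Sum>j\<in>I. a' j * G j k p)
        + (\<Sum>i\<in>I. \<Sum>j\<in>I. a' i * a' j * G i j p)"
      using insert.hyps by (simp add: sum.distrib sum_distrib_left algebra_simps)
    also have "\<dots> = a' k * a' k * G k k p + 2 * a' k * s + (\<Sum>i\<in>I. \<Sum>j\<in>I. a i * a j * G i j p)"
      unfolding sk by (simp add: a'I)
    also have "a' k * a' k * G k k p = R p * s * s"
      using Rp by (simp add: a'_def algebra_simps)
    also have "R p * s * s + 2 * a' k * s = - (R p * (s * s))"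
      by (simp add: a'_def)
    also have "s * s = (\<Sum>i\<in>I. \<Sum>j\<in>I. a i * a j * (G i k p * G k j p))"
      unfolding s_def sum_product
      by (intro sum.cong refl) (use sym[of _ k] in \<open>simp add: algebra_simps\<close>)
    finally have "(\<Sum>i\<in>insert k I. \<Sum>j\<in>insert k I. a' i * a' j * G i j p) = 
        (\<Sum>i\<in>I. \<Sum>j\<in>I. a i * a j * G' i j p)"
      by (simp add: G'_def sum_distrib_left sum_subtractf algebra_simps)
    moreover have "\<exists>i\<in>insert k I. a' i \<noteq> 0" using a a'I by auto
    ultimately show "(\<Sum>i\<in>I. \<Sum>j\<in>I. a i * a j * G' i j p) > 0"
      using pos[of a'] by simp
  qed
  then obtain c where c: "\<And>i. smooth_fun A (c i)"
    and ev: "\<forall>\<^sub>F q in nhds p. \<forall>i\<in>I. (\<Sum>j\<in>I. G' i j q * c j q) = b' i q" by blast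
  \<comment> \<open>Back substitution: equation k is solved for the unknown with index k.\<close>
  define d where "d i = (if i = k then (\<lambda>q. (b k q - (\<Sum>j\<in>I. G k j q * c j q)) * R q) else c i)" for i
  have "smooth_fun A (d i)" for i
    by (auto simp: d_def intro!: c smooth_fun_diff smooth_fun_mult smooth_fun_sum smG smb R)
  moreover have "\<forall>\<^sub>F q in nhds p. \<forall>i\<in>insert k I. (\<Sum>j\<in>insert k I. G i j q * d j q) = b i q"
    using R(2) ev
  proof eventually_elim
    case (elim q)
    have dI: "(\<Sum>j\<in>I. G i j q * d j q) = (\<Sum>j\<in>I. G i j q * c j q)" for i
      by (intro sum.cong refl) (use insert.hyps in \<open>auto simp: d_def\<close>)
    show ?case
    proof
      fix i assume i: "i \<in> insert k I"
      have split: "(\<Sum>j\<in>insert k I. G i j q * d j q) = 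
          G i k q * (b k q - (\<Sum>j\<in>I. G k j q * c j q)) * R q + (\<Sum>j\<in>I. G i j q * c j q)"
        using insert.hyps by (simp add: dI) (simp add: d_def)
      show "(\<Sum>j\<in>insert k I. G i j q * d j q) = b i q"
      proof (cases "i = k")
        case True
        have "G k k q * y * R q = y" for y
          using elim(1) by (metis mult.assoc mult.commute mult_1)
        from split[unfolded True this] show ?thesis by (simp add: True)
      next
        case False
        then have "(\<Sum>j\<in>I. G i j q * c j q) - G i k q * R q * (\<Sum>j\<in>I. G k j q * c j q) = b i q - G i k q * b k q * R q"
          using elim(2) i by (simp add: G'_def b'_def sum_distrib_left sum_subtractf algebra_simps)
        then show ?thesis unfolding split by (simp add: algebra_simps)
      qed
    qed
  qed
  ultimately show ?case by blast
qed

end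

section \<open>Tangent vectors and local frames\<close>


lemma scale_vec_simps [simp]:
  "(c *\<^sub>v u) f = c * u f" "c *\<^sub>v (u + w) = c *\<^sub>v u + c *\<^sub>v w" "1 *\<^sub>v u = u" "0 *\<^sub>v u = 0" "c *\<^sub>v 0 = 0"
  "c *\<^sub>v d *\<^sub>v u = (c * d) *\<^sub>v u" "- (c *\<^sub>v u) = (- c) *\<^sub>v u"
  by (auto simp: scale_vec_def fun_eq_iff algebra_simps)

context manifold
begin

section \<open>Algebra and locality of derivations\<close>

lemma tangent_add: "u \<in> tangent_space A p \<Longrightarrow> smooth_fun A f \<Longrightarrow> smooth_fun A h \<Longrightarrow> u (\<lambda>q. f q + h q) = u f + u h"
  by (auto simp: tangent_space_def func_plus)

lemma tangent_mult:
  "u \<in> tangent_space A p \<Longrightarrow> smooth_fun A f \<Longrightarrow> smooth_fun A h \<Longrightarrow> u (\<lambda>q. f q * h q) = u f * h p + f p * u h"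
  by (auto simp: tangent_space_def func_times)

lemma tangent_scale: "u \<in> tangent_space A p \<Longrightarrow> smooth_fun A f \<Longrightarrow> u (\<lambda>q. c * f q) = c * u f"
  by (auto simp: tangent_space_def)

lemma tangent_not_smooth: "u \<in> tangent_space A p \<Longrightarrow> \<not> smooth_fun A f \<Longrightarrow> u f = 0"
  by (auto simp: tangent_space_def)

lemma tangentI:
  assumes "\<And>f h. smooth_fun A f \<Longrightarrow> smooth_fun A h \<Longrightarrow> u (\<lambda>q. f q + h q) = u f + u h"
    "\<And>c f. smooth_fun A f \<Longrightarrow> u (\<lambda>q. c * f q) = c * u f"
    "\<And>f h. smooth_fun A f \<Longrightarrow> smooth_fun A h \<Longrightarrow> u (\<lambda>q. f q * h q) = u f * h p + f p * u h"
    "\<And>f. \<not> smooth_fun A f \<Longrightarrow> u f = 0"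
  shows "u \<in> tangent_space A p"
  using assms by (auto simp: tangent_space_def func_plus func_times)

lemma tangent_zero_fun: "u \<in> tangent_space A p \<Longrightarrow> u (\<lambda>q. 0) = 0"
  using tangent_scale[OF _ smooth_fun_const, of u p 0 0] by simp

lemma tangent_const: "u \<in> tangent_space A p \<Longrightarrow> u (\<lambda>q. c) = 0"
  using tangent_mult[OF _ smooth_fun_const smooth_fun_const, of u p 1 1]
    tangent_scale[OF _ smooth_fun_const, of u p c 1] by simp

lemma tangent_diff:
  assumes "u \<in> tangent_space A p" "smooth_fun A f" "smooth_fun A h"
  shows "u (\<lambda>q. f q - h q) = u f - u h"
  using tangent_add[OF assms(1,2) smooth_fun_mult[OF smooth_fun_const[of "-1"] assms(3)]]
    tangent_scale[OF assms(1,3), of "-1"] by simp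

lemma tangent_sum:
  assumes "u \<in> tangent_space A p" "\<And>i. i \<in> I \<Longrightarrow> smooth_fun A (f i)"
  shows "u (\<lambda>q. \<Sum>i\<in>I. f i q) = (\<Sum>i\<in>I. u (f i))"
  using assms(2)
  by (induction I rule: infinite_finite_induct)
     (auto simp: tangent_const[OF assms(1)] tangent_add[OF assms(1)] smooth_fun_sum)

lemma tangent_plus: "u \<in> tangent_space A p \<Longrightarrow> w \<in> tangent_space A p \<Longrightarrow> u + w \<in> tangent_space A p"
  by (intro tangentI) (auto simp: tangent_add tangent_scale tangent_mult tangent_not_smooth algebra_simps)

lemma tangent_scale_vec: "u \<in> tangent_space A p \<Longrightarrow> c *\<^sub>v u \<in> tangent_space A p"
  by (intro tangentI) (auto simp: tangent_add tangent_scale tangent_mult tangent_not_smooth algebra_simps)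

lemma tangent_zero: "0 \<in> tangent_space A p"
  by (intro tangentI) auto

lemma tangent_uminus: "u \<in> tangent_space A p \<Longrightarrow> - u \<in> tangent_space A p"
  by (intro tangentI) (auto simp: tangent_add tangent_scale tangent_mult tangent_not_smooth algebra_simps)

lemma tangent_minus: "u \<in> tangent_space A p \<Longrightarrow> w \<in> tangent_space A p \<Longrightarrow> u - w \<in> tangent_space A p"
  using tangent_plus[OF _ tangent_uminus, of u p w] by simp

lemma tangent_Sum: "(\<And>i. i \<in> I \<Longrightarrow> u i \<in> tangent_space A p) \<Longrightarrow> (\<Sum>i\<in>I. u i) \<in> tangent_space A p"
  by (induction I rule: infinite_finite_induct) (auto intro: tangent_zero tangent_plus)

text \<open>Multiply f - h by a bump function b that is 1 near p and vanishes off the set where f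
  and h agree. The product is identically zero, and the product rule at p turns this into
  \<open>u f - u h = 0\<close>.\<close>

lemma tangent_local:
  assumes u: "u \<in> tangent_space A p" and f: "smooth_fun A f" "smooth_fun A h" and eq: "\<forall>\<^sub>F q in nhds p. f q = h q"
  shows "u f = u h"
proof -
  obtain S where S: "open S" "p \<in> S" "\<And>q. q \<in> S \<Longrightarrow> f q = h q"
    using eq by (auto simp: eventually_nhds)
  obtain U x where U: "(U, x) \<in> A" "p \<in> U" by (rule chart_at)
  obtain b K where b: "smooth_fun A b" "K \<subseteq> S \<inter> U" "\<And>q. q \<notin> K \<Longrightarrow> b q = 0" "\<forall>\<^sub>F q in nhds p. b q = 1"
    by (rule smooth_fun_extend[OF U(1) _ _ _ smooth_on_const, of p "S \<inter> U" 1]) (use S U chart(1) in auto)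
  have "b p = 1" using b(4) by (rule eventually_nhds_x_imp_x)
  have "b q * (f q - h q) = 0" for q
    using b(2,3) S(3) by (cases "q \<in> K") auto
  then have "u (\<lambda>q. b q * (f q - h q)) = 0"
    using tangent_const[OF u, of 0] by (simp only:)
  then show ?thesis
    using tangent_mult[OF u b(1) smooth_fun_diff[OF f]] tangent_diff[OF u f] S \<open>b p = 1\<close> by simp
qed

lemma vfieldD: "X \<in> vector_fields A \<Longrightarrow> X p \<in> tangent_space A p"
  by (auto simp: vector_fields_def)

lemma vfield_smooth: "X \<in> vector_fields A \<Longrightarrow> smooth_fun A f \<Longrightarrow> smooth_fun A (\<lambda>q. X q f)"
  by (auto simp: vector_fields_def deriv_along_def)

lemma vfieldI:
  "(\<And>p. X p \<in> tangent_space A p) \<Longrightarrow> (\<And>f. smooth_fun A f \<Longrightarrow> smooth_fun A (\<lambda>q. X q f)) \<Longrightarrow> X \<in> vector_fields A"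
  by (auto simp: vector_fields_def deriv_along_def)

lemma vfield_plus: "X \<in> vector_fields A \<Longrightarrow> Y \<in> vector_fields A \<Longrightarrow> X + Y \<in> vector_fields A"
  by (intro vfieldI) (auto intro: tangent_plus vfieldD smooth_fun_add vfield_smooth)

lemma vfield_scale: "smooth_fun A c \<Longrightarrow> X \<in> vector_fields A \<Longrightarrow> c *\<^sub>f X \<in> vector_fields A"
  by (intro vfieldI) (auto simp: scale_field_def intro: tangent_scale_vec vfieldD smooth_fun_mult vfield_smooth)

lemma vfield_zero: "0 \<in> vector_fields A"
  by (intro vfieldI) (auto intro: tangent_zero smooth_fun_const)

lemma vfield_minus: "X \<in> vector_fields A \<Longrightarrow> Y \<in> vector_fields A \<Longrightarrow> X - Y \<in> vector_fields A"
  by (intro vfieldI) (auto intro: tangent_minus vfieldD smooth_fun_diff vfield_smooth)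

lemma vfield_sum: "(\<And>i. i \<in> I \<Longrightarrow> X i \<in> vector_fields A) \<Longrightarrow> (\<Sum>i\<in>I. X i) \<in> vector_fields A"
  by (induction I rule: infinite_finite_induct) (auto intro: vfield_zero vfield_plus)

text \<open>Meant for the horizontal lift, which is defined point by point and agrees near each
  point with a field constructed there.\<close>

lemma vfield_eventually:
  assumes "\<And>p. X p \<in> tangent_space A p"
    and "\<And>p. \<exists>Y \<in> vector_fields A. \<forall>\<^sub>F q in nhds p. X q = Y q"
  shows "X \<in> vector_fields A"
proof (rule vfieldI[OF assms(1)])
  fix f assume f: "smooth_fun A f"
  show "smooth_fun A (\<lambda>q. X q f)"
  proof (rule smooth_fun_eventually)
    fix p
    obtain Y where "Y \<in> vector_fields A" "\<forall>\<^sub>F q in nhds p. X q = Y q" using assms(2) by blast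
    then show "\<exists>h. smooth_fun A h \<and> (\<forall>\<^sub>F q in nhds p. X q f = h q)"
      using vfield_smooth[OF _ f] by (intro exI[of _ "\<lambda>q. Y q f"]) (auto elim: eventually_mono)
  qed
qed

section \<open>Coordinate fields and local frames\<close>

text \<open>The value 0 on functions that are not smooth is forced by the convention in
  \<open>tangent_space\<close>.\<close>

definition coord_deriv :: "'m set \<Rightarrow> ('m \<Rightarrow> 'e) \<Rightarrow> 'e \<Rightarrow> 'm vfield" where
  "coord_deriv U x i q f =
     (if smooth_fun A f then frechet_derivative (\<lambda>z. f (inv_into U x z)) (at (x q)) i else 0)"

lemma coord_deriv_tangent:
  assumes U: "(U, x) \<in> A" and q: "q \<in> U"
  shows "coord_deriv U x i q \<in> tangent_space A q"
proof (rule tangentI)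
  have der: "((\<lambda>z. f (inv_into U x z)) has_derivative frechet_derivative (\<lambda>z. f (inv_into U x z)) (at (x q))) (at (x q))"
    if "smooth_fun A f" for f
    by (rule smooth_on_has_derivative[OF smooth_funD[OF that U subset_refl]]) (use q in auto)
  note fd = frechet_derivative_at[symmetric]
  fix f h and c :: real assume f: "smooth_fun A f"
  show "coord_deriv U x i q (\<lambda>q. c * f q) = c * coord_deriv U x i q f"
    using f fd[OF has_derivative_mult_right[OF der[OF f], of c]]
    by (simp add: coord_deriv_def smooth_fun_mult smooth_fun_const)
  assume h: "smooth_fun A h"
  show "coord_deriv U x i q (\<lambda>q. f q + h q) = coord_deriv U x i q f + coord_deriv U x i q h"
    using f h fd[OF has_derivative_add[OF der[OF f] der[OF h]]]
    by (simp add: coord_deriv_def smooth_fun_add)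
  show "coord_deriv U x i q (\<lambda>q. f q * h q) = coord_deriv U x i q f * h q + f q * coord_deriv U x i q h"
    using f h fd[OF has_derivative_mult[OF der[OF f] der[OF h]]] chart(5)[OF U q]
    by (simp add: coord_deriv_def smooth_fun_mult)
qed (simp add: coord_deriv_def)

lemma coord_deriv_coord:
  assumes U: "(U, x) \<in> A" and q: "q \<in> U" and Y: "smooth_fun A Y" "\<forall>\<^sub>F q' in nhds q. Y q' = x q' \<bullet> j"
  shows "coord_deriv U x i q Y = i \<bullet> j"
proof -
  obtain S where S: "open S" "q \<in> S" "\<And>q. q \<in> S \<Longrightarrow> Y q = x q \<bullet> j"
    using Y(2) by (auto simp: eventually_nhds)
  have op: "open (x ` (U \<inter> S))"
    by (rule open_chart_image[OF U]) (use S chart(1)[OF U] in auto)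
  have "((\<lambda>z. Y (inv_into U x z)) has_derivative (\<lambda>v. v \<bullet> j)) (at (x q))"
    by (rule has_derivative_transform_within_open[OF bounded_linear_imp_has_derivative[OF bounded_linear_inner_left] op])
       (use S chart(5)[OF U] q in auto)
  from frechet_derivative_at[OF this, symmetric] show ?thesis
    using Y(1) by (simp add: coord_deriv_def)
qed

text \<open>By Hadamard's lemma f is, near q, the constant \<open>f q\<close> plus the sum of the
  products of \<open>Y i - Y i q\<close> with smooth \<open>H i\<close>. The first factors vanish at
  q, so the product rule leaves only \<open>u (Y i) * H i q\<close>, and \<open>H i q\<close> is the
  partial derivative of f.\<close>

lemma tangent_expand:
  assumes U: "(U, x) \<in> A" and q: "q \<in> U" and u: "u \<in> tangent_space A q"
    and Y: "\<And>i. i \<in> Basis \<Longrightarrow> smooth_fun A (Y i)"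
      "\<forall>\<^sub>F q' in nhds q. \<forall>i\<in>Basis. Y i q' = x q' \<bullet> i"
  shows "u = (\<Sum>i\<in>Basis. u (Y i) *\<^sub>v coord_deriv U x i q)"
proof
  fix f
  show "u f = (\<Sum>i\<in>Basis. u (Y i) *\<^sub>v coord_deriv U x i q) f"
  proof (cases "smooth_fun A f")
    case f: True
    let ?f = "\<lambda>z. f (inv_into U x z)"
    obtain r where r: "r > 0" "ball (x q) r \<subseteq> x ` U"
      using chart(2)[OF U] q open_contains_ball by blast
    have "smooth_on (ball (x q) r) ?f"
      using smooth_on_subset[OF smooth_funD[OF f U subset_refl] r(2)] .
    then obtain h where h: "\<And>i. smooth_on (ball (x q) r) (h i)"
      and exp: "\<And>z. z \<in> ball (x q) r \<Longrightarrow> ?f z = ?f (x q) + (\<Sum>i\<in>Basis. ((z - x q) \<bullet> i) * h i z)"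
      and hq: "\<And>i. h i (x q) = frechet_derivative ?f (at (x q)) i"
      by (rule smooth_on_ball_expand) blast
    let ?W = "U \<inter> x -` ball (x q) r"
    have W: "q \<in> ?W" "open ?W" "?W \<subseteq> U"
      using q r open_chart_preimage[OF U open_ball] by auto
    have "\<exists>H. smooth_fun A H \<and> (\<forall>\<^sub>F q' in nhds q. H q' = h i (x q'))" for i
      by (rule smooth_fun_extend[OF U W smooth_on_subset[OF h[of i]]]) auto
    then obtain H where H: "\<And>i. smooth_fun A (H i)" "\<And>i. \<forall>\<^sub>F q' in nhds q. H i q' = h i (x q')"
      by metis
    have Hq: "H i q = coord_deriv U x i q f" for i
      using eventually_nhds_x_imp_x[OF H(2)] f by (simp add: hq coord_deriv_def)
    have Yq: "\<forall>i\<in>Basis. Y i q = x q \<bullet> i"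
      using eventually_nhds_x_imp_x[OF Y(2)] by simp
    have sm: "smooth_fun A (\<lambda>q'. (Y i q' - Y i q) * H i q')" if "i \<in> Basis" for i
      by (intro smooth_fun_mult smooth_fun_diff Y H that smooth_fun_const)
    have "\<forall>\<^sub>F q' in nhds q. \<forall>i\<in>Basis. H i q' = h i (x q')"
      using H(2) by (simp add: eventually_ball_finite_distrib)
    moreover have "\<forall>\<^sub>F q' in nhds q. q' \<in> ?W"
      by (rule eventually_nhds_in_open[OF W(2,1)])
    ultimately have "\<forall>\<^sub>F q' in nhds q. f q' = f q + (\<Sum>i\<in>Basis. (Y i q' - Y i q) * H i q')"
      using Y(2)
    proof eventually_elim
      case (elim q')
      then show ?case
        using exp[of "x q'"] chart(5)[OF U] q Yq by (auto simp: inner_diff_left)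
    qed
    then have "u f = u (\<lambda>q'. f q + (\<Sum>i\<in>Basis. (Y i q' - Y i q) * H i q'))"
      by (intro tangent_local[OF u f] smooth_fun_add smooth_fun_const smooth_fun_sum sm)
    also have "\<dots> = (\<Sum>i\<in>Basis. u (\<lambda>q'. (Y i q' - Y i q) * H i q'))"
      by (simp add: tangent_add[OF u smooth_fun_const smooth_fun_sum] tangent_const[OF u] tangent_sum[OF u] sm)
    also have "\<dots> = (\<Sum>i\<in>Basis. u (Y i) * coord_deriv U x i q f)"
      by (intro sum.cong refl)
         (simp add: tangent_mult[OF u smooth_fun_diff[OF Y(1) smooth_fun_const] H(1)]
          tangent_diff[OF u Y(1) smooth_fun_const] tangent_const[OF u] Hq)
    finally show ?thesis by (simp add: sum_fun_apply)
  qed (simp add: sum_fun_apply tangent_not_smooth[OF u] coord_deriv_def)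
qed

text \<open>A chart in global form: Y stands for the coordinates and E for the coordinate fields,
  both extended to the whole manifold and meaningful only near p. The two clauses say that they are
  dual and that E spans.\<close>

definition frame_at :: "'m \<Rightarrow> ('e \<Rightarrow> 'm \<Rightarrow> real) \<Rightarrow> ('e \<Rightarrow> 'm vfield) \<Rightarrow> bool" where
  "frame_at p Y E \<longleftrightarrow> (\<forall>i. smooth_fun A (Y i) \<and> E i \<in> vector_fields A) \<and>
    (\<forall>\<^sub>F q in nhds p. (\<forall>i\<in>Basis. \<forall>j\<in>Basis. E i q (Y j) = (if i = j then 1 else 0)) \<and>
       (\<forall>u\<in>tangent_space A q. u = (\<Sum>i\<in>Basis. u (Y i) *\<^sub>v E i q)))"

lemma frame_atD:
  assumes "frame_at p Y E"
  shows "smooth_fun A (Y i)" "E i \<in> vector_fields A"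
    "\<forall>\<^sub>F q in nhds p. \<forall>u\<in>tangent_space A q. u = (\<Sum>i\<in>Basis. u (Y i) *\<^sub>v E i q)"
    "i \<in> Basis \<Longrightarrow> j \<in> Basis \<Longrightarrow> E i p (Y j) = (if i = j then 1 else 0)"
  using assms eventually_nhds_x_imp_x unfolding frame_at_def by (blast, blast, fastforce elim: eventually_mono, fast)

lemma local_frame: obtains Y E where "frame_at p Y E"
proof -
  obtain U x where U: "(U, x) \<in> A" "p \<in> U" by (rule chart_at)
  have opU: "open U" by (rule chart(1)[OF U(1)])
  have "\<exists>Y. smooth_fun A Y \<and> (\<forall>\<^sub>F q in nhds p. Y q = x q \<bullet> i)" for i
    by (rule smooth_fun_extend[OF U opU subset_refl, of "\<lambda>z. z \<bullet> i"])
       (use smooth_on_inner[OF chart(2)[OF U(1)] smooth_on_ident[OF chart(2)[OF U(1)]]] in auto)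
  then obtain Y where Y: "\<And>i. smooth_fun A (Y i)" "\<And>i. \<forall>\<^sub>F q in nhds p. Y i q = x q \<bullet> i"
    by metis
  obtain b K where b: "smooth_fun A b" "closed K" "K \<subseteq> U" "\<And>q. q \<notin> K \<Longrightarrow> b q = 0" "\<forall>\<^sub>F q in nhds p. b q = 1"
    by (rule smooth_fun_extend[OF U opU subset_refl smooth_on_const[of _ 1]]) blast
  \<comment> \<open>The cut-off b vanishes outside a closed subset of U, so the extension by 0 is
    smooth across the boundary of U.\<close>
  define E where "E i q = (if q \<in> U then b q *\<^sub>v coord_deriv U x i q else 0)" for i q
  have E: "E i \<in> vector_fields A" for i
  proof (rule vfieldI)
    show "E i q \<in> tangent_space A q" for q
      by (auto simp: E_def intro: tangent_zero tangent_scale_vec coord_deriv_tangent[OF U(1)])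
    fix f assume f: "smooth_fun A f"
    show "smooth_fun A (\<lambda>q. E i q f)"
    proof (rule smooth_fun_eventually)
      fix q
      show "\<exists>h. smooth_fun A h \<and> (\<forall>\<^sub>F q in nhds q. E i q f = h q)"
      proof (cases "q \<in> U")
        case True
        obtain h L where h: "smooth_fun A h" 
          "\<forall>\<^sub>F q' in nhds q. h q' = frechet_derivative (\<lambda>z. f (inv_into U x z)) (at (x q')) i"
          by (rule smooth_fun_extend[OF U(1) True opU subset_refl 
                smooth_on_frechet_derivative[OF smooth_funD[OF f U(1) subset_refl]]])
        have "\<forall>\<^sub>F q' in nhds q. q' \<in> U" by (rule eventually_nhds_in_open[OF opU True])
        with h(2) have "\<forall>\<^sub>F q' in nhds q. E i q' f = b q' * h q'"
          by eventually_elim (use f in \<open>simp add: E_def coord_deriv_def\<close>)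
        then show ?thesis using smooth_fun_mult[OF b(1) h(1)] by blast
      next
        case False
        then have "\<forall>\<^sub>F q' in nhds q. q' \<in> - K"
          using b by (intro eventually_nhds_in_open) auto
        then have "\<forall>\<^sub>F q' in nhds q. E i q' f = 0"
          by eventually_elim (use b(4) in \<open>auto simp: E_def\<close>)
        then show ?thesis using smooth_fun_const by blast
      qed
    qed
  qed
  have "\<forall>\<^sub>F q in nhds p. \<forall>i\<in>Basis. Y i q = x q \<bullet> i"
    using Y(2) by (simp add: eventually_ball_finite_distrib)
  \<comment> \<open>Evaluating derivations at q requires that Y agree with the coordinates in a
    neighbourhood of q, not just at q.\<close>
  then have "\<forall>\<^sub>F q in nhds p. \<forall>\<^sub>F q' in nhds q. \<forall>i\<in>Basis. Y i q' = x q' \<bullet> i"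
    by (simp add: eventually_eventually)
  moreover have "\<forall>\<^sub>F q in nhds p. q \<in> U" by (rule eventually_nhds_in_open[OF opU U(2)])
  ultimately have "\<forall>\<^sub>F q in nhds p. (\<forall>i\<in>Basis. \<forall>j\<in>Basis. E i q (Y j) = (if i = j then 1 else 0)) \<and>
       (\<forall>u\<in>tangent_space A q. u = (\<Sum>i\<in>Basis. u (Y i) *\<^sub>v E i q))"
    using b(5)
  proof eventually_elim
    case (elim q)
    have Eq: "E i q = coord_deriv U x i q" for i using elim by (simp add: E_def)
    have "coord_deriv U x i q (Y j) = i \<bullet> j" if "j \<in> Basis" for i j
      by (rule coord_deriv_coord[OF U(1) elim(2) Y(1)]) (use elim(1) that in \<open>auto elim: eventually_mono\<close>)
    then show ?case
      unfolding Eq using tangent_expand[OF U(1) elim(2) _ Y(1) elim(1)] by (auto simp: inner_Basis)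
  qed
  then show thesis using that Y(1) E unfolding frame_at_def by blast
qed

text \<open>Connections and lifts act on fields only; this allows a single tangent vector to be
  tested by a field through it.\<close>

lemma vfield_through:
  assumes "u \<in> tangent_space A p"
  obtains X where "X \<in> vector_fields A" "X p = u"
proof -
  obtain Y E where "frame_at p Y E" by (rule local_frame)
  note E = frame_atD(2)[OF this] and ev = frame_atD(3)[OF this]
  show thesis
  proof (rule that)
    show "(\<Sum>i\<in>Basis. (\<lambda>q. u (Y i)) *\<^sub>f E i) \<in> vector_fields A"
      by (intro vfield_sum vfield_scale smooth_fun_const E)
    show "(\<Sum>i\<in>Basis. (\<lambda>q. u (Y i)) *\<^sub>f E i) p = u"
      using eventually_nhds_x_imp_x[OF ev] assms by (simp add: sum_fun_apply scale_field_def)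
  qed
qed

end

section \<open>Gradients and horizontal lifts\<close>


locale riemannian = manifold A
  for A :: "('m::{t2_space,second_countable_topology}, 'e::euclidean_space) atlas" +
  fixes g :: "'m metric"
  assumes metric: "riemannian_metric A g"
begin

lemma metric_sym: "u \<in> tangent_space A p \<Longrightarrow> w \<in> tangent_space A p \<Longrightarrow> g p u w = g p w u"
  and metric_scale_left: "u \<in> tangent_space A p \<Longrightarrow> w \<in> tangent_space A p \<Longrightarrow> g p (c *\<^sub>v u) w = c * g p u w"
  and metric_add_left: "u \<in> tangent_space A p \<Longrightarrow> w \<in> tangent_space A p \<Longrightarrow> u' \<in> tangent_space A p \<Longrightarrow>
    g p (u + u') w = g p u w + g p u' w"
  and metric_pos: "u \<in> tangent_space A p \<Longrightarrow> u \<noteq> 0 \<Longrightarrow> g p u u > 0"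
  and smooth_metric: "X \<in> vector_fields A \<Longrightarrow> Y \<in> vector_fields A \<Longrightarrow> smooth_fun A (\<lambda>q. g q (X q) (Y q))"
  using metric unfolding riemannian_metric_def by blast+

lemma metric_add_right: "u \<in> tangent_space A p \<Longrightarrow> w \<in> tangent_space A p \<Longrightarrow> u' \<in> tangent_space A p \<Longrightarrow>
    g p w (u + u') = g p w u + g p w u'"
  using metric_add_left metric_sym tangent_plus by metis

lemma metric_zero_left: "w \<in> tangent_space A p \<Longrightarrow> g p 0 w = 0"
  using metric_scale_left[of w p w 0] by simp

lemma metric_scale_right: "u \<in> tangent_space A p \<Longrightarrow> w \<in> tangent_space A p \<Longrightarrow> g p w (c *\<^sub>v u) = c * g p w u"
  using metric_scale_left metric_sym tangent_scale_vec by metis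

lemma metric_diff_left: "u \<in> tangent_space A p \<Longrightarrow> w \<in> tangent_space A p \<Longrightarrow> u' \<in> tangent_space A p \<Longrightarrow>
    g p (u - u') w = g p u w - g p u' w"
  using metric_add_left[of "u - u'" p w u'] tangent_minus[of u p u'] by simp

lemma metric_diff_right: "u \<in> tangent_space A p \<Longrightarrow> w \<in> tangent_space A p \<Longrightarrow> u' \<in> tangent_space A p \<Longrightarrow>
    g p w (u - u') = g p w u - g p w u'"
  using metric_diff_left metric_sym tangent_minus by metis

lemma metric_uminus_left: "u \<in> tangent_space A p \<Longrightarrow> w \<in> tangent_space A p \<Longrightarrow> g p (- u) w = - g p u w"
  using metric_diff_left[of 0 p w u] metric_zero_left tangent_zero by simp

lemma metric_sum_left:
  assumes "\<And>i. i \<in> I \<Longrightarrow> u i \<in> tangent_space A p" "w \<in> tangent_space A p"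
  shows "g p (\<Sum>i\<in>I. u i) w = (\<Sum>i\<in>I. g p (u i) w)"
  using assms(1)
  by (induction I rule: infinite_finite_induct)
     (auto simp: metric_zero_left assms(2) metric_add_left tangent_Sum)

lemma metric_sum_right:
  assumes "\<And>i. i \<in> I \<Longrightarrow> u i \<in> tangent_space A p" "w \<in> tangent_space A p"
  shows "g p w (\<Sum>i\<in>I. u i) = (\<Sum>i\<in>I. g p w (u i))"
proof -
  have "g p w (\<Sum>i\<in>I. u i) = g p (\<Sum>i\<in>I. u i) w"
    by (rule metric_sym[OF assms(2) tangent_Sum[OF assms(1)]])
  also have "\<dots> = (\<Sum>i\<in>I. g p (u i) w)"
    by (rule metric_sum_left[OF assms])
  also have "\<dots> = (\<Sum>i\<in>I. g p w (u i))"
    by (intro sum.cong refl metric_sym assms)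
  finally show ?thesis .
qed

lemma metric_eq_0D: "u \<in> tangent_space A p \<Longrightarrow> g p u u = 0 \<Longrightarrow> u = 0"
  using metric_pos by force

text \<open>The double sum is the squared length of the combination. This is how the positivity
  hypothesis of \<open>solve_positive_definite\<close> gets verified.\<close>

lemma gram_positive:
  assumes u: "\<And>i. i \<in> I \<Longrightarrow> u i \<in> tangent_space A p" and "(\<Sum>i\<in>I. a i *\<^sub>v u i) \<noteq> 0"
  shows "(\<Sum>i\<in>I. \<Sum>j\<in>I. a i * a j * g p (u i) (u j)) > 0"
proof -
  let ?s = "\<Sum>i\<in>I. a i *\<^sub>v u i"
  have s: "?s \<in> tangent_space A p"
    by (intro tangent_Sum tangent_scale_vec u)
  have "g p ?s ?s = (\<Sum>i\<in>I. g p (a i *\<^sub>v u i) ?s)"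
    by (rule metric_sum_left[OF _ s]) (intro tangent_scale_vec u)
  also have "\<dots> = (\<Sum>i\<in>I. \<Sum>j\<in>I. a i * a j * g p (u i) (u j))"
    by (intro sum.cong refl)
       (simp add: metric_scale_left metric_sum_right metric_scale_right u s tangent_scale_vec sum_distrib_left algebra_simps)
  finally show ?thesis using metric_pos[OF s assms(2)] by simp
qed

text \<open>The components of the gradient in a local frame solve the linear system whose matrix is
  the Gram matrix of the frame.\<close>

lemma local_gradient:
  assumes f: "smooth_fun A f"
  obtains X where "X \<in> vector_fields A" "\<forall>\<^sub>F q in nhds p. \<forall>u\<in>tangent_space A q. g q (X q) u = u f"
proof -
  obtain Y E where "frame_at p Y E" by (rule local_frame)
  note E = frame_atD(2)[OF this] and ev = frame_atD(3)[OF this] and Ep = frame_atD(4)[OF this]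
  have "\<exists>c. (\<forall>i. smooth_fun A (c i)) \<and> 
      (\<forall>\<^sub>F q in nhds p. \<forall>i\<in>Basis. (\<Sum>j\<in>Basis. g q (E i q) (E j q) * c j q) = E i q f)"
  proof (rule solve_positive_definite)
    fix a :: "'e \<Rightarrow> real" assume "\<exists>i\<in>Basis. a i \<noteq> 0"
    then obtain k where k: "k \<in> Basis" "a k \<noteq> 0" by blast
    \<comment> \<open>Evaluation at \<open>Y k\<close> picks out the coefficient with index k, so
      the frame is linearly independent at p.\<close>
    have "(\<Sum>i\<in>Basis. a i *\<^sub>v E i p) (Y k) = (\<Sum>i\<in>Basis. a i * (if i = k then 1 else 0))"
      using k(1) Ep by (auto simp: sum_fun_apply intro!: sum.cong)
    also have "\<dots> = (\<Sum>i\<in>Basis. if i = k then a i else 0)"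
      by (intro sum.cong) auto
    also have "\<dots> = a k" using k(1) by simp
    finally have "(\<Sum>i\<in>Basis. a i *\<^sub>v E i p) \<noteq> 0" using k(2) by auto
    then show "0 < (\<Sum>i\<in>Basis. \<Sum>j\<in>Basis. a i * a j * g p (E i p) (E j p))"
      by (intro gram_positive vfieldD E)
  qed (auto intro: smooth_metric E vfield_smooth f metric_sym vfieldD)
  then obtain c where c: "\<And>i. smooth_fun A (c i)"
    and sol: "\<forall>\<^sub>F q in nhds p. \<forall>i\<in>Basis. (\<Sum>j\<in>Basis. g q (E i q) (E j q) * c j q) = E i q f"
    by blast
  define X where "X = (\<Sum>j\<in>Basis. c j *\<^sub>f E j)"
  have Xq: "X q = (\<Sum>j\<in>Basis. c j q *\<^sub>v E j q)" for q
    by (simp add: X_def sum_fun_apply scale_field_def)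
  have X: "X \<in> vector_fields A"
    unfolding X_def by (intro vfield_sum vfield_scale c E)
  have "\<forall>\<^sub>F q in nhds p. \<forall>u\<in>tangent_space A q. g q (X q) u = u f"
    using ev sol
  proof eventually_elim
    case (elim q)
    note T = vfieldD[OF E] vfieldD[OF X] tangent_scale_vec
    show ?case
    proof
      fix u assume u: "u \<in> tangent_space A q"
      have gE: "g q (X q) (E i q) = E i q f" if "i \<in> Basis" for i
      proof -
        have "g q (X q) (E i q) = (\<Sum>j\<in>Basis. g q (E i q) (E j q) * c j q)"
          unfolding Xq by (simp add: metric_sum_left metric_scale_left T metric_sym[of "E i q"] mult.commute)
        then show ?thesis using elim that by simp
      qed
      have u_eq: "u = (\<Sum>i\<in>Basis. u (Y i) *\<^sub>v E i q)"
        using elim u by blast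
      have "g q (X q) u = g q (X q) (\<Sum>i\<in>Basis. u (Y i) *\<^sub>v E i q)"
        using u_eq by simp
      also have "\<dots> = (\<Sum>i\<in>Basis. u (Y i) * E i q f)"
        by (simp add: metric_sum_right metric_scale_right T gE)
      also have "\<dots> = u f"
        using fun_cong[OF u_eq, of f] by (simp add: sum_fun_apply)
      finally show "g q (X q) u = u f" .
    qed
  qed
  with X show thesis by (rule that)
qed

end

section \<open>Horizontal lifts along a Riemannian submersion\<close>

locale submersion = riemannian M g + N: riemannian N g'
  for M :: "('m::{t2_space,second_countable_topology}, 'e::euclidean_space) atlas" and g
    and N :: "('n::{t2_space,second_countable_topology}, 'd::euclidean_space) atlas" and g' +
  fixes \<pi> :: "'m \<Rightarrow> 'n"
  assumes riemannian_submersion: "riemannian_submersion M g N g' \<pi>"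
begin

abbreviation "d\<pi> \<equiv> differential N \<pi>"

lemma smooth_pullback:
  assumes f: "smooth_fun N f"
  shows "smooth_fun M (\<lambda>p. f (\<pi> p))"
proof (rule smooth_funI)
  fix p
  obtain U x where U: "(U, x) \<in> M" "p \<in> U" by (rule chart_at)
  obtain V y where V: "(V, y) \<in> N" "\<pi> p \<in> V" by (rule N.chart_at)
  have sm: "smooth_map M N \<pi>"
    using riemannian_submersion by (simp add: riemannian_submersion_def)
  let ?W = "U \<inter> \<pi> -` V"
  have "open (\<pi> -` V)"
    using sm N.chart(1)[OF V(1)] by (simp add: smooth_map_def open_vimage)
  then have op: "open ?W" using chart(1)[OF U(1)] by auto
  have inv: "\<pi> (inv_into U x z) \<in> V" if "z \<in> x ` ?W" for z
    using that chart(5)[OF U(1)] by auto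
  have "smooth_on (x ` ?W) (\<lambda>z. f (inv_into V y (y (\<pi> (inv_into U x z)))))"
  proof (rule smooth_on_compose[OF open_chart_image[OF U(1) op] N.smooth_funD[OF f V(1) subset_refl]])
    show "smooth_on (x ` ?W) (\<lambda>z. y (\<pi> (inv_into U x z)))"
    proof -
      have "\<forall>(U, x)\<in>M. \<forall>(V, y)\<in>N. smooth_on (x ` (U \<inter> \<pi> -` V)) (y \<circ> \<pi> \<circ> inv_into U x)"
        using sm by (simp add: smooth_map_def)
      from bspec[OF bspec[OF this U(1), unfolded split] V(1), unfolded split] show ?thesis
        by (simp add: o_def)
    qed
    show "(\<lambda>z. y (\<pi> (inv_into U x z))) ` x ` ?W \<subseteq> y ` V"
      using inv by blast
  qed simp
  then have "smooth_on (x ` ?W) (\<lambda>z. f (\<pi> (inv_into U x z)))"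
    by (rule smooth_on_cong[OF _ open_chart_image[OF U(1) op]])
       (simp, simp only: N.chart(5)[OF V(1) inv])
  then show "\<exists>U x W. (U, x) \<in> M \<and> p \<in> W \<and> open W \<and> W \<subseteq> U \<and> smooth_on (x ` W) (\<lambda>z. f (\<pi> (inv_into U x z)))"
    using U(1) op by (intro exI[of _ U] exI[of _ x] exI[of _ ?W]) (use U(2) V(2) in simp)
qed

lemma differential_apply: "smooth_fun N f \<Longrightarrow> d\<pi> u f = u (\<lambda>p. f (\<pi> p))"
  by (simp add: differential_def o_def)

lemma differential_image: "d\<pi> ` tangent_space M p = tangent_space N (\<pi> p)"
  using riemannian_submersion by (simp add: riemannian_submersion_def)

lemma differential_tangent: "u \<in> tangent_space M p \<Longrightarrow> d\<pi> u \<in> tangent_space N (\<pi> p)"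
  using differential_image by blast

lemma differential_surj:
  assumes "w \<in> tangent_space N (\<pi> p)"
  obtains u where "u \<in> tangent_space M p" "d\<pi> u = w"
proof -
  have "w \<in> d\<pi> ` tangent_space M p"
    using assms by (simp only: differential_image)
  then show thesis by (rule imageE) (simp add: that)
qed

lemma differential_plus: "d\<pi> (u + w) = d\<pi> u + d\<pi> w"
  and differential_minus: "d\<pi> (u - w) = d\<pi> u - d\<pi> w"
  and differential_zero: "d\<pi> 0 = 0"
  by (rule ext, simp add: differential_def)+

abbreviation "\<H> \<equiv> horizontal_space M g N \<pi>"
abbreviation "\<V> \<equiv> vertical_space M N \<pi>"

text \<open>The difference of the two vectors is vertical and orthogonal to all vertical vectors,
  hence to itself.\<close>

lemma horizontal_unique:
  assumes "u \<in> \<H> p" "w \<in> \<H> p" "d\<pi> u = d\<pi> w"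
  shows "u = w"
proof -
  have T: "u \<in> tangent_space M p" "w \<in> tangent_space M p" using assms by (auto simp: horizontal_space_def)
  then have uw: "u - w \<in> tangent_space M p" by (rule tangent_minus)
  then have "u - w \<in> \<V> p" using assms(3) by (simp add: vertical_space_def differential_minus)
  then have "g p (u - w) (u - w) = 0"
    using assms(1,2) uw T by (auto simp: horizontal_space_def metric_diff_left)
  then show ?thesis using metric_eq_0D[OF uw] by simp
qed

text \<open>X is the basic field over \<open>X'\<close> in O'Neill's terminology.\<close>

definition lifts :: "'m vfield \<Rightarrow> 'n vfield \<Rightarrow> bool" where
  "lifts X X' \<longleftrightarrow> X \<in> vector_fields M \<and> (\<forall>p. X p \<in> \<H> p \<and> d\<pi> (X p) = X' (\<pi> p))"

text \<open>Near \<open>p\<close> the lift is the combination of the gradients of the pulled back coordinate functions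
  that solves the linear system given by their Gram matrix.\<close>

lemma local_lift:
  assumes X': "X' \<in> vector_fields N"
  shows "\<exists>X \<in> vector_fields M. \<forall>\<^sub>F q in nhds p. X q \<in> \<H> q \<and> d\<pi> (X q) = X' (\<pi> q)"
proof -
  obtain Y E where "N.frame_at (\<pi> p) Y E" by (rule N.local_frame)
  note Y = N.frame_atD(1)[OF this] and E = N.frame_atD(2)[OF this]
    and evN = N.frame_atD(3)[OF this] and Ep = N.frame_atD(4)[OF this]
  let ?Y = "\<lambda>i p. Y i (\<pi> p)"
  have "continuous_on UNIV \<pi>"
    using riemannian_submersion by (simp add: riemannian_submersion_def smooth_map_def)
  then have "filterlim \<pi> (nhds (\<pi> p)) (nhds p)"
    by (simp add: continuous_on_eq_continuous_at isCont_def tendsto_at_iff_tendsto_nhds)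
  then have ev: "\<forall>\<^sub>F q in nhds p. \<forall>u\<in>tangent_space N (\<pi> q). u = (\<Sum>i\<in>Basis. u (Y i) *\<^sub>v E i (\<pi> q))"
    using evN by (auto simp: filterlim_iff elim: eventually_mono)
  have "\<forall>i. \<exists>G. G \<in> vector_fields M \<and> (\<forall>\<^sub>F q in nhds p. \<forall>u\<in>tangent_space M q. g q (G q) u = u (?Y i))"
    by (rule allI, rule local_gradient[OF smooth_pullback[OF Y]]) blast
  from choice[OF this] obtain G where "\<forall>i. G i \<in> vector_fields M \<and>
      (\<forall>\<^sub>F q in nhds p. \<forall>u\<in>tangent_space M q. g q (G i q) u = u (?Y i))" ..
  then have G: "G i \<in> vector_fields M"
    and gradG: "\<forall>\<^sub>F q in nhds p. \<forall>u\<in>tangent_space M q. g q (G i q) u = u (?Y i)" for i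
    by blast+
  have grad: "\<forall>\<^sub>F q in nhds p. \<forall>i\<in>Basis. \<forall>u\<in>tangent_space M q. g q (G i q) u = u (?Y i)"
    using gradG by (simp add: eventually_ball_finite_distrib)
  have "\<exists>c. (\<forall>i. smooth_fun M (c i)) \<and> 
      (\<forall>\<^sub>F q in nhds p. \<forall>i\<in>Basis. (\<Sum>j\<in>Basis. g q (G i q) (G j q) * c j q) = X' (\<pi> q) (Y i))"
  proof (rule solve_positive_definite)
    fix a :: "'d \<Rightarrow> real" assume "\<exists>i\<in>Basis. a i \<noteq> 0"
    then obtain k where k: "k \<in> Basis" "a k \<noteq> 0" by blast
    \<comment> \<open>A vector over \<open>E k\<close> pairs to 1 with the gradient of the k-th
      pulled back coordinate and to 0 with the others, so these gradients are independent at p.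
      Surjectivity of the differential enters here.\<close>
    obtain u where u: "u \<in> tangent_space M p" "d\<pi> u = E k (\<pi> p)"
      by (rule differential_surj[OF N.vfieldD[OF E]])
    have "g p (\<Sum>i\<in>Basis. a i *\<^sub>v G i p) u = (\<Sum>i\<in>Basis. a i * g p (G i p) u)"
      by (simp add: metric_sum_left metric_scale_left tangent_scale_vec vfieldD[OF G] u)
    also have "\<dots> = (\<Sum>i\<in>Basis. a i * E k (\<pi> p) (Y i))"
      using eventually_nhds_x_imp_x[OF grad] u by (intro sum.cong refl) (simp add: differential_apply[OF Y, symmetric])
    also have "\<dots> = (\<Sum>i\<in>Basis. if i = k then a i else 0)"
      by (intro sum.cong refl) (use k(1) Ep in auto)
    also have "\<dots> = a k" using k(1) by simp
    finally have "(\<Sum>i\<in>Basis. a i *\<^sub>v G i p) \<noteq> 0" 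
      using k(2) metric_zero_left[OF u(1)] by auto
    then show "0 < (\<Sum>i\<in>Basis. \<Sum>j\<in>Basis. a i * a j * g p (G i p) (G j p))"
      by (intro gram_positive vfieldD G)
  qed (auto intro: smooth_metric G smooth_pullback[OF N.vfield_smooth[OF X' Y]] metric_sym vfieldD)
  then obtain c where c: "\<And>i. smooth_fun M (c i)"
    and sol: "\<forall>\<^sub>F q in nhds p. \<forall>i\<in>Basis. (\<Sum>j\<in>Basis. g q (G i q) (G j q) * c j q) = X' (\<pi> q) (Y i)"
    by blast
  define X where "X = (\<Sum>j\<in>Basis. c j *\<^sub>f G j)"
  have Xq: "X q = (\<Sum>j\<in>Basis. c j q *\<^sub>v G j q)" for q
    by (simp add: X_def sum_fun_apply scale_field_def)
  have X: "X \<in> vector_fields M"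
    unfolding X_def by (intro vfield_sum vfield_scale c G)
  have "\<forall>\<^sub>F q in nhds p. X q \<in> \<H> q \<and> d\<pi> (X q) = X' (\<pi> q)"
    using ev grad sol
  proof eventually_elim
    case (elim q)
    note T = vfieldD[OF G] vfieldD[OF X] tangent_scale_vec
    \<comment> \<open>The product with u depends on u through \<open>d\<pi> u\<close> only, which is
      why \<open>X q\<close> is orthogonal to the vertical space.\<close>
    have gX: "g q (X q) u = (\<Sum>j\<in>Basis. c j q * d\<pi> u (Y j))" if "u \<in> tangent_space M q" for u
      unfolding Xq using that elim(2)
      by (simp add: metric_sum_left metric_scale_left T differential_apply Y)
    have "X q \<in> \<H> q"
      using T(2) by (auto simp: horizontal_space_def vertical_space_def gX)
    moreover have "d\<pi> (X q) (Y i) = X' (\<pi> q) (Y i)" if i: "i \<in> Basis" for i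
    proof -
      have "d\<pi> (X q) (Y i) = g q (G i q) (X q)"
        using elim(2) i T(2) by (simp add: differential_apply Y)
      also have "\<dots> = (\<Sum>j\<in>Basis. g q (G i q) (G j q) * c j q)"
        unfolding Xq using i by (simp add: metric_sum_right metric_scale_right T mult.commute)
      finally show ?thesis using elim(3) i by simp
    qed
    moreover have "d\<pi> (X q) = (\<Sum>i\<in>Basis. d\<pi> (X q) (Y i) *\<^sub>v E i (\<pi> q))"
      "X' (\<pi> q) = (\<Sum>i\<in>Basis. X' (\<pi> q) (Y i) *\<^sub>v E i (\<pi> q))"
      using elim(1) differential_tangent[OF T(2)] N.vfieldD[OF X'] by blast+
    ultimately show ?case by simp
  qed
  with X show ?thesis by blast
qed

text \<open>Uniqueness of horizontal vectors over a given vector makes the local lifts agree, so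
  they define a single global field without a partition of unity.\<close>

lemma lift_exists:
  assumes X': "X' \<in> vector_fields N"
  obtains X where "lifts X X'"
proof -
  define X where "X p = (THE u. u \<in> \<H> p \<and> d\<pi> u = X' (\<pi> p))" for p
  have eq: "X q = u" if "u \<in> \<H> q" "d\<pi> u = X' (\<pi> q)" for q u
    unfolding X_def
  proof (rule the_equality)
    show "w = u" if "w \<in> \<H> q \<and> d\<pi> w = X' (\<pi> q)" for w
      by (rule horizontal_unique) (use \<open>u \<in> \<H> q\<close> \<open>d\<pi> u = X' (\<pi> q)\<close> that in auto)
  qed (use that in simp)
  have X: "X p \<in> \<H> p \<and> d\<pi> (X p) = X' (\<pi> p)" for p
  proof -
    obtain Z where "\<forall>\<^sub>F q in nhds p. Z q \<in> \<H> q \<and> d\<pi> (Z q) = X' (\<pi> q)"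
      using local_lift[OF X'] by blast
    from eventually_nhds_x_imp_x[OF this] show ?thesis
      using eq[of "Z p" p] by simp
  qed
  have "X \<in> vector_fields M"
  proof (rule vfield_eventually)
    show "X p \<in> tangent_space M p" for p using X[of p] by (simp add: horizontal_space_def)
    fix p
    obtain Z where Z: "Z \<in> vector_fields M" and ev: "\<forall>\<^sub>F q in nhds p. Z q \<in> \<H> q \<and> d\<pi> (Z q) = X' (\<pi> q)"
      using local_lift[OF X'] by blast
    from ev have "\<forall>\<^sub>F q in nhds p. X q = Z q"
    proof eventually_elim
      case (elim q)
      then show ?case using eq[of "Z q" q] by simp
    qed
    with Z show "\<exists>Z \<in> vector_fields M. \<forall>\<^sub>F q in nhds p. X q = Z q" by blast
  qed
  with X have "lifts X X'" by (simp add: lifts_def)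
  then show thesis by (rule that)
qed

end

section \<open>O'Neill's curvature formula\<close>


locale levi_civita = riemannian A g
  for A :: "('m::{t2_space,second_countable_topology}, 'e::euclidean_space) atlas" and g +
  fixes D :: "'m connection"
  assumes levi_civita: "levi_civita_connection A g D"
begin

lemma D_vfield: "X \<in> vector_fields A \<Longrightarrow> Y \<in> vector_fields A \<Longrightarrow> D X Y \<in> vector_fields A"
  and D_add_left: "X \<in> vector_fields A \<Longrightarrow> Y \<in> vector_fields A \<Longrightarrow> Z \<in> vector_fields A \<Longrightarrow>
    D (X + Z) Y = D X Y + D Z Y"
  and D_add_right: "X \<in> vector_fields A \<Longrightarrow> Y \<in> vector_fields A \<Longrightarrow> Z \<in> vector_fields A \<Longrightarrow>
    D X (Y + Z) = D X Y + D X Z"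
  and torsion_free: "X \<in> vector_fields A \<Longrightarrow> Y \<in> vector_fields A \<Longrightarrow> D X Y - D Y X = lie_bracket X Y"
  using levi_civita by (auto simp: levi_civita_connection_def affine_connection_def)

lemma metric_compatible:
  assumes "X \<in> vector_fields A" "Y \<in> vector_fields A" "Z \<in> vector_fields A"
  shows "X p (\<lambda>q. g q (Y q) (Z q)) = g p (D X Y p) (Z p) + g p (Y p) (D X Z p)"
proof -
  have "deriv_along X (\<lambda>q. g q (Y q) (Z q)) = (\<lambda>q. g q (D X Y q) (Z q) + g q (Y q) (D X Z q))"
    using levi_civita assms by (auto simp: levi_civita_connection_def)
  from fun_cong[OF this, of p] show ?thesis by (simp add: deriv_along_def)
qed

lemma D_zero_right:
  assumes "X \<in> vector_fields A"
  shows "D X 0 = 0"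
  using D_add_right[OF assms vfield_zero vfield_zero] by simp

lemma lie_bracket_vfield: "X \<in> vector_fields A \<Longrightarrow> Y \<in> vector_fields A \<Longrightarrow> lie_bracket X Y \<in> vector_fields A"
  using torsion_free vfield_minus D_vfield by metis

lemma D_diff_left:
  assumes "X \<in> vector_fields A" "Y \<in> vector_fields A" "Z \<in> vector_fields A"
  shows "D (X - Z) Y = D X Y - D Z Y"
  using D_add_left[OF vfield_minus[OF assms(1,3)] assms(2,3)] by simp

text \<open>The right-hand side contains only metric and brackets, both of which are under control
  for lifts; this is the bridge between D and \<open>D'\<close>.\<close>

lemma koszul:
  assumes X: "X \<in> vector_fields A" and Y: "Y \<in> vector_fields A" and Z: "Z \<in> vector_fields A"
  shows "2 * g p (D X Y p) (Z p) =
    X p (\<lambda>q. g q (Y q) (Z q)) + Y p (\<lambda>q. g q (X q) (Z q)) - Z p (\<lambda>q. g q (X q) (Y q))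
    + g p (lie_bracket X Y p) (Z p) - g p (lie_bracket X Z p) (Y p) - g p (lie_bracket Y Z p) (X p)"
proof -
  note T = vfieldD[OF X] vfieldD[OF Y] vfieldD[OF Z] vfieldD[OF D_vfield]
  have br: "g p (lie_bracket U V p) (W p) = g p (D U V p) (W p) - g p (D V U p) (W p)"
    if "U \<in> vector_fields A" "V \<in> vector_fields A" "W \<in> vector_fields A" for U V W
    using that by (simp add: torsion_free[symmetric] metric_diff_left vfieldD D_vfield)
  show ?thesis
    using metric_sym[OF T(3) T(4)[OF Y X]] metric_sym[OF T(2) T(4)[OF X Z]]
      metric_sym[OF T(1) T(4)[OF Y Z]] metric_sym[OF T(1) T(4)[OF Z Y]] metric_sym[OF T(2) T(4)[OF Z X]]
    by (simp add: metric_compatible br X Y Z)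
qed

text \<open>Second covariant derivatives are traded for derivatives of functions such as g (D Y Z)
  W. For lifts these functions are pulled back from N, whereas the field \<open>D Y Z\<close> is in
  general no lift.\<close>

lemma curvature_eq:
  assumes X: "X \<in> vector_fields A" and Y: "Y \<in> vector_fields A" and Z: "Z \<in> vector_fields A"
    and W: "W \<in> vector_fields A"
  shows "curvature g D X Y Z W p =
    (X p (\<lambda>q. g q (D Y Z q) (W q)) - g p (D Y Z p) (D X W p))
    - (Y p (\<lambda>q. g q (D X Z q) (W q)) - g p (D X Z p) (D Y W p))
    - g p (D (lie_bracket X Y) Z p) (W p)"
  using metric_compatible[OF X D_vfield[OF Y Z] W, of p] metric_compatible[OF Y D_vfield[OF X Z] W, of p]
  by (simp add: curvature_def curvature_operator_def metric_diff_left vfieldD D_vfield vfield_minus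
      lie_bracket_vfield tangent_minus assms)

end

section \<open>Lifts and the two Levi-Civita connections\<close>

locale levi_civita_submersion = submersion M g N g' \<pi> + levi_civita M g D + N: levi_civita N g' D'
  for M :: "('m::{t2_space,second_countable_topology}, 'e::euclidean_space) atlas" and g
    and N :: "('n::{t2_space,second_countable_topology}, 'd::euclidean_space) atlas" and g' and \<pi> and D D'
begin

lemma liftsD:
  assumes "lifts X X'"
  shows "X \<in> vector_fields M" "X p \<in> \<H> p" "d\<pi> (X p) = X' (\<pi> p)" "X p \<in> tangent_space M p"
  using assms vfieldD by (auto simp: lifts_def)

lemma lifts_pullback: "lifts X X' \<Longrightarrow> smooth_fun N f \<Longrightarrow> X p (\<lambda>q. f (\<pi> q)) = X' (\<pi> p) f"
  using differential_apply[of f "X p"] liftsD(3)[of X X' p] by simp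

lemma lifts_metric:
  assumes "lifts X X'" "lifts Y Y'"
  shows "g p (X p) (Y p) = g' (\<pi> p) (X' (\<pi> p)) (Y' (\<pi> p))"
  using riemannian_submersion liftsD(2,3)[OF assms(1), of p] liftsD(2,3)[OF assms(2), of p]
  unfolding riemannian_submersion_def by metis

lemma vertical_horizontal:
  assumes "w \<in> \<V> p" "u \<in> \<H> p"
  shows "g p w u = 0" "g p u w = 0"
  using assms metric_sym[of w p u] by (auto simp: horizontal_space_def vertical_space_def)

lemma horizontal_minus: "u \<in> \<H> p \<Longrightarrow> w \<in> \<H> p \<Longrightarrow> u - w \<in> \<H> p"
  by (auto simp: horizontal_space_def vertical_space_def metric_diff_left tangent_minus)

lemma lifts_minus: "lifts X X' \<Longrightarrow> lifts Y Y' \<Longrightarrow> lifts (X - Y) (X' - Y')"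
  by (simp add: lifts_def vfield_minus horizontal_minus differential_minus)

text \<open>Stated for \<pi>-related fields and not only for lifts, because it is also applied to a
  vertical field, which is related to 0.\<close>

lemma differential_lie_bracket:
  assumes X: "X \<in> vector_fields M" "\<And>p. d\<pi> (X p) = X' (\<pi> p)" and Y: "Y \<in> vector_fields M" "\<And>p. d\<pi> (Y p) = Y' (\<pi> p)"
    and X': "X' \<in> vector_fields N" and Y': "Y' \<in> vector_fields N"
  shows "d\<pi> (lie_bracket X Y p) = lie_bracket X' Y' (\<pi> p)"
proof
  fix f
  show "d\<pi> (lie_bracket X Y p) f = lie_bracket X' Y' (\<pi> p) f"
  proof (cases "smooth_fun N f")
    case True
    have pull: "X q (\<lambda>p. h (\<pi> p)) = X' (\<pi> q) h" "Y q (\<lambda>p. h (\<pi> p)) = Y' (\<pi> q) h" if "smooth_fun N h" for h q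
      using differential_apply[OF that, of "X q"] differential_apply[OF that, of "Y q"] X(2)[of q] Y(2)[of q]
      by simp_all
    show ?thesis
      using True pull(1)[OF N.vfield_smooth[OF Y' True]] pull(2)[OF N.vfield_smooth[OF X' True]]
      by (simp add: pull differential_apply lie_bracket_def deriv_along_def)
  next
    case False
    then show ?thesis
      using N.tangent_not_smooth[OF N.vfieldD[OF N.lie_bracket_vfield[OF X' Y']] False]
      by (simp add: differential_def)
  qed
qed

lemma lifts_lie_bracket:
  assumes "lifts X X'" "lifts Y Y'" "X' \<in> vector_fields N" "Y' \<in> vector_fields N"
  shows "d\<pi> (lie_bracket X Y p) = lie_bracket X' Y' (\<pi> p)"
  by (rule differential_lie_bracket) (use assms liftsD in auto)

text \<open>Subtracting from u a horizontal vector with the same image leaves a vertical vector,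
  which is orthogonal to Z; on horizontal vectors \<pi> is isometric.\<close>

lemma horizontal_metric_differential:
  assumes "u \<in> tangent_space M p" "lifts Z Z'"
  shows "g p u (Z p) = g' (\<pi> p) (d\<pi> u) (Z' (\<pi> p))"
proof -
  obtain W' where W': "W' \<in> vector_fields N" "W' (\<pi> p) = d\<pi> u"
    by (rule N.vfield_through[OF differential_tangent[OF assms(1)]])
  obtain W where W: "lifts W W'" by (rule lift_exists[OF W'(1)])
  have "u - W p \<in> \<V> p"
    using assms(1) liftsD(3,4)[OF W] W'(2) by (simp add: vertical_space_def differential_minus tangent_minus)
  then have "g p (u - W p) (Z p) = 0"
    by (rule vertical_horizontal[OF _ liftsD(2)[OF assms(2)]])
  then show ?thesis
    using lifts_metric[OF W assms(2), of p] W'(2) by (simp add: metric_diff_left assms(1) liftsD(4)[OF W] liftsD(4)[OF assms(2)])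
qed

text \<open>For lifts, each term of the Koszul formula on M equals the corresponding term on
  N.\<close>

lemma lifts_connection_metric:
  assumes X: "lifts X X'" and Y: "lifts Y Y'" and Z: "lifts Z Z'"
    and X': "X' \<in> vector_fields N" and Y': "Y' \<in> vector_fields N" and Z': "Z' \<in> vector_fields N"
  shows "g p (D X Y p) (Z p) = g' (\<pi> p) (D' X' Y' (\<pi> p)) (Z' (\<pi> p))"
proof -
  have der: "U p (\<lambda>q. g q (V q) (W q)) = U' (\<pi> p) (\<lambda>q. g' q (V' q) (W' q))"
    if "lifts U U'" "lifts V V'" "lifts W W'" "V' \<in> vector_fields N" "W' \<in> vector_fields N" for U V W U' V' W'
    using lifts_pullback[OF that(1) N.smooth_metric[OF that(4,5)], of p] by (simp add: lifts_metric[OF that(2,3)])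
  have br: "g p (lie_bracket U V p) (W p) = g' (\<pi> p) (lie_bracket U' V' (\<pi> p)) (W' (\<pi> p))"
    if "lifts U U'" "lifts V V'" "lifts W W'" "U' \<in> vector_fields N" "V' \<in> vector_fields N" for U V W U' V' W'
    using horizontal_metric_differential[OF vfieldD[OF lie_bracket_vfield] that(3), of U V p] that
    by (simp add: lifts_lie_bracket liftsD)
  show ?thesis
    using koszul[OF liftsD(1)[OF X] liftsD(1)[OF Y] liftsD(1)[OF Z], of p] N.koszul[OF X' Y' Z', of "\<pi> p"]
    by (simp add: der[OF X Y Z Y' Z'] der[OF Y X Z X' Z'] der[OF Z X Y X' Y'] br[OF X Y Z X' Y'] br[OF X Z Y X' Z'] br[OF Y Z X Y' Z'])
qed

text \<open>Nondegeneracy of \<open>g'\<close>: the difference of the two sides is extended to a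
  field on N, whose lift serves as test field, so the difference has length 0.\<close>

lemma differential_connection:
  assumes X: "lifts X X'" and Y: "lifts Y Y'" and X': "X' \<in> vector_fields N" and Y': "Y' \<in> vector_fields N"
  shows "d\<pi> (D X Y p) = D' X' Y' (\<pi> p)"
proof -
  have DT: "D X Y p \<in> tangent_space M p"
    by (intro vfieldD D_vfield liftsD(1)[OF X] liftsD(1)[OF Y])
  have D'T: "D' X' Y' (\<pi> p) \<in> tangent_space N (\<pi> p)"
    by (intro N.vfieldD N.D_vfield X' Y')
  note T = N.tangent_minus[OF differential_tangent[OF DT] D'T]
  obtain Z' where Z': "Z' \<in> vector_fields N" "Z' (\<pi> p) = d\<pi> (D X Y p) - D' X' Y' (\<pi> p)"
    by (rule N.vfield_through[OF T])
  obtain Z where Z: "lifts Z Z'" by (rule lift_exists[OF Z'(1)])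
  have "g' (\<pi> p) (d\<pi> (D X Y p) - D' X' Y' (\<pi> p)) (Z' (\<pi> p)) = 0"
    using lifts_connection_metric[OF X Y Z X' Y' Z'(1), of p] horizontal_metric_differential[OF DT Z]
    by (simp add: N.metric_diff_left differential_tangent DT D'T N.vfieldD Z'(1))
  then show ?thesis
    using N.metric_eq_0D[OF T] Z'(2) by simp
qed


section \<open>The vertical part of the connection on lifts\<close>

lemma lifts_unique:
  assumes "lifts X X'" "lifts Y X'"
  shows "X = Y"
proof
  fix p
  show "X p = Y p"
    by (rule horizontal_unique) (use liftsD(2,3)[OF assms(1)] liftsD(2,3)[OF assms(2)] in auto)
qed

definition lift :: "'n vfield \<Rightarrow> 'm vfield" where
  "lift X' = (SOME X. lifts X X')"

lemma lift: "X' \<in> vector_fields N \<Longrightarrow> lifts (lift X') X'"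
  unfolding lift_def using lift_exists[of X'] someI_ex[of "\<lambda>X. lifts X X'"] by blast

lemma lift_eq: "lifts X X' \<Longrightarrow> X' \<in> vector_fields N \<Longrightarrow> lift X' = X"
  using lift lifts_unique by blast

lemma lift_vfield: "X' \<in> vector_fields N \<Longrightarrow> lift X' \<in> vector_fields M"
  using lift liftsD(1) by blast

lemma lift_diff: "X' \<in> vector_fields N \<Longrightarrow> Y' \<in> vector_fields N \<Longrightarrow> lift (X' - Y') = lift X' - lift Y'"
  by (intro lift_eq lifts_minus lift N.vfield_minus)

text \<open>The O'Neill tensor of the lifts of \<open>X'\<close> and \<open>Y'\<close>.\<close>

definition vpart :: "'n vfield \<Rightarrow> 'n vfield \<Rightarrow> 'm vfield" where
  "vpart X' Y' = D (lift X') (lift Y') - lift (D' X' Y')"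

lemma vpart_vfield: "X' \<in> vector_fields N \<Longrightarrow> Y' \<in> vector_fields N \<Longrightarrow> vpart X' Y' \<in> vector_fields M"
  unfolding vpart_def by (intro vfield_minus D_vfield lift_vfield N.D_vfield)

lemma vpart_vertical:
  assumes "X' \<in> vector_fields N" "Y' \<in> vector_fields N"
  shows "vpart X' Y' p \<in> \<V> p"
  using vfieldD[OF vpart_vfield[OF assms], of p] differential_connection[OF lift[OF assms(1)] lift[OF assms(2)] assms, of p]
    liftsD(3)[OF lift[OF N.D_vfield[OF assms]], of p]
  by (simp add: vertical_space_def vpart_def differential_minus)

lemma vpart_diff_left:
  assumes "X' \<in> vector_fields N" "Y' \<in> vector_fields N" "Z' \<in> vector_fields N"
  shows "vpart (X' - Z') Y' = vpart X' Y' - vpart Z' Y'"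
  using assms by (simp add: vpart_def lift_diff D_diff_left N.D_diff_left lift_vfield N.D_vfield)

lemma vpart_uminus_left:
  assumes "X' \<in> vector_fields N" "Y' \<in> vector_fields N"
  shows "vpart (- X') Y' = - vpart X' Y'"
  using vpart_diff_left[OF assms(1,2,1)] vpart_diff_left[OF N.vfield_zero assms(2,1)] by simp

text \<open>The bracket of a lift with a vertical field is vertical, so the product with
  \<open>lift Z'\<close> does not change when \<open>D V (lift Y')\<close> is replaced by
  \<open>D (lift Y') V\<close>. As V is orthogonal to \<open>lift Z'\<close>, the derivative then
  moves over to \<open>lift Z'\<close> with a minus sign.\<close>

lemma D_vertical:
  assumes V: "V \<in> vector_fields M" "\<And>p. V p \<in> \<V> p" and Y': "Y' \<in> vector_fields N" and Z': "Z' \<in> vector_fields N"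
  shows "g p (D V (lift Y') p) (lift Z' p) = - g p (V p) (vpart Y' Z' p)"
proof -
  note Y = lift_vfield[OF Y'] and Z = lift_vfield[OF Z']
  have "d\<pi> (lie_bracket (lift Y') V p) = lie_bracket Y' 0 (\<pi> p)"
    by (rule differential_lie_bracket[OF Y _ V(1) _ Y' N.vfield_zero])
       (use liftsD(3)[OF lift[OF Y']] V(2) in \<open>auto simp: vertical_space_def\<close>)
  also have "\<dots> = 0"
    using N.tangent_zero_fun[OF N.vfieldD[OF Y'], of "\<pi> p"] by (simp add: lie_bracket_def deriv_along_def fun_eq_iff)
  finally have "lie_bracket (lift Y') V p \<in> \<V> p"
    by (simp add: vertical_space_def vfieldD lie_bracket_vfield Y V(1))
  then have "g p (lie_bracket (lift Y') V p) (lift Z' p) = 0"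
    by (rule vertical_horizontal(1)[OF _ liftsD(2)[OF lift[OF Z']]])
  then have "g p (D V (lift Y') p) (lift Z' p) = g p (D (lift Y') V p) (lift Z' p)"
    by (simp add: torsion_free[OF Y V(1), symmetric] metric_diff_left vfieldD D_vfield Y V(1) Z)
  also have "\<dots> = - g p (V p) (D (lift Y') (lift Z') p)"
    using metric_compatible[OF Y V(1) Z, of p] tangent_zero_fun[OF vfieldD[OF Y], of p]
    by (simp add: vertical_horizontal(1)[OF V(2) liftsD(2)[OF lift[OF Z']]])
  also have "D (lift Y') (lift Z') p = vpart Y' Z' p + lift (D' Y' Z') p"
    by (simp add: vpart_def)
  also have "g p (V p) \<dots> = g p (V p) (vpart Y' Z' p)"
    by (simp add: metric_add_right vfieldD V(1) vpart_vfield lift_vfield N.D_vfield Y' Z'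
        vertical_horizontal(1)[OF V(2) liftsD(2)[OF lift[OF N.D_vfield[OF Y' Z']]]])
  finally show ?thesis .
qed

text \<open>The metric product of the lifts is pulled back from N, hence constant along the vertical
  field V, the sum that should vanish. Differentiating it along V and applying
  \<open>D_vertical\<close> to both terms shows that V has length 0.\<close>

lemma vpart_skew:
  assumes X': "X' \<in> vector_fields N" and Y': "Y' \<in> vector_fields N"
  shows "vpart Y' X' = - vpart X' Y'"
proof -
  define V where "V = vpart X' Y' + vpart Y' X'"
  note v = vpart_vfield[OF X' Y'] vpart_vfield[OF Y' X']
  have V: "V \<in> vector_fields M" unfolding V_def by (intro vfield_plus v)
  have vert: "V p \<in> \<V> p" for p
    using vpart_vertical[OF X' Y', of p] vpart_vertical[OF Y' X', of p]
    by (simp add: V_def vertical_space_def tangent_plus differential_plus)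
  have "V p = 0" for p
  proof -
    have "V p (\<lambda>q. g q (lift X' q) (lift Y' q)) = d\<pi> (V p) (\<lambda>q. g' q (X' q) (Y' q))"
      by (simp add: differential_apply N.smooth_metric X' Y' lifts_metric[OF lift[OF X'] lift[OF Y']])
    also have "\<dots> = 0" using vert[of p] by (simp add: vertical_space_def)
    finally have "g p (V p) (vpart X' Y' p) + g p (V p) (vpart Y' X' p) = 0"
      using metric_compatible[OF V lift_vfield[OF X'] lift_vfield[OF Y'], of p]
        D_vertical[OF V vert X' Y', of p] D_vertical[OF V vert Y' X', of p]
        metric_sym[OF vfieldD[OF lift_vfield[OF X']] vfieldD[OF D_vfield[OF V lift_vfield[OF Y']]], of p]
      by simp
    then have "g p (V p) (V p) = 0"
      using metric_add_right[OF vfieldD[OF v(1)] vfieldD[OF V] vfieldD[OF v(2)], of p] by (simp add: V_def)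
    then show "V p = 0" by (rule metric_eq_0D[OF vfieldD[OF V]])
  qed
  then have "vpart X' Y' p + vpart Y' X' p = 0" for p by (simp add: V_def)
  then show ?thesis by (simp add: fun_eq_iff add_eq_0_iff)
qed

text \<open>Expand both curvatures by \<open>curvature_eq\<close>. The derivatives of functions
  agree, and the corrections come from vertical parts: those of the connection inside the metric
  products, and that of the bracket in the last term.\<close>

lemma oneill_curvature:
  assumes X': "X' \<in> vector_fields N" and Y': "Y' \<in> vector_fields N" and Z': "Z' \<in> vector_fields N"
    and W': "W' \<in> vector_fields N"
  shows "curvature g' D' X' Y' Z' W' (\<pi> p) = curvature g D (lift X') (lift Y') (lift Z') (lift W') p
    + g p (vpart Y' Z' p) (vpart X' W' p) - g p (vpart X' Z' p) (vpart Y' W' p)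
    - 2 * g p (vpart X' Y' p) (vpart Z' W' p)"
proof -
  \<comment> \<open>Applied twice, with the first two arguments exchanged; it yields the first two
    corrections.\<close>
  have first: "lift X1 p (\<lambda>q. g q (D (lift Y1) (lift Z') q) (lift W' q)) - g p (D (lift Y1) (lift Z') p) (D (lift X1) (lift W') p) =
      X1 (\<pi> p) (\<lambda>q. g' q (D' Y1 Z' q) (W' q)) - g' (\<pi> p) (D' Y1 Z' (\<pi> p)) (D' X1 W' (\<pi> p))
      - g p (vpart Y1 Z' p) (vpart X1 W' p)"
    if X1: "X1 \<in> vector_fields N" and Y1: "Y1 \<in> vector_fields N" for X1 Y1
  proof -
    let ?h = "lift (D' Y1 Z') p" and ?k = "lift (D' X1 W') p"
    note YZ = N.D_vfield[OF Y1 Z'] and XW = N.D_vfield[OF X1 W']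
    have T: "?h \<in> tangent_space M p" "?k \<in> tangent_space M p" "vpart Y1 Z' p \<in> tangent_space M p"
      "vpart X1 W' p \<in> tangent_space M p"
      by (intro vfieldD lift_vfield vpart_vfield YZ XW X1 Y1 Z' W')+
    have o: "g p (vpart Y1 Z' p) ?k = 0" "g p ?h (vpart X1 W' p) = 0"
      by (intro vertical_horizontal vpart_vertical liftsD(2)[OF lift] YZ XW X1 Y1 Z' W')+
    have "D (lift Y1) (lift Z') p = vpart Y1 Z' p + ?h" "D (lift X1) (lift W') p = vpart X1 W' p + ?k"
      by (simp_all add: vpart_def)
    then have "g p (D (lift Y1) (lift Z') p) (D (lift X1) (lift W') p) = 
        g p (vpart Y1 Z' p) (vpart X1 W' p) + g' (\<pi> p) (D' Y1 Z' (\<pi> p)) (D' X1 W' (\<pi> p))"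
      using lifts_metric[OF lift[OF YZ] lift[OF XW], of p]
      by (simp add: metric_add_left metric_add_right T tangent_plus o)
    moreover have "lift X1 p (\<lambda>q. g q (D (lift Y1) (lift Z') q) (lift W' q)) = X1 (\<pi> p) (\<lambda>q. g' q (D' Y1 Z' q) (W' q))"
      unfolding lifts_connection_metric[OF lift[OF Y1] lift[OF Z'] lift[OF W'] Y1 Z' W']
      by (rule lifts_pullback[OF lift[OF X1] N.smooth_metric[OF YZ W']])
    ultimately show ?thesis by simp
  qed
  note XY = N.D_vfield[OF X' Y'] and YX = N.D_vfield[OF Y' X'] and br = N.lie_bracket_vfield[OF X' Y']
  \<comment> \<open>The vertical part of the bracket of the lifts. By skew-symmetry it is twice
    \<open>vpart X' Y'\<close>, which is the source of the factor 2.\<close>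
  define V where "V = vpart X' Y' - vpart Y' X'"
  have V: "V \<in> vector_fields M" unfolding V_def by (intro vfield_minus vpart_vfield X' Y')
  have vert: "V q \<in> \<V> q" for q
    using vpart_vertical[OF X' Y', of q] vpart_vertical[OF Y' X', of q]
    by (simp add: V_def vertical_space_def tangent_minus differential_minus)
  have "lie_bracket (lift X') (lift Y') = lift (lie_bracket X' Y') + V"
    unfolding V_def vpart_def torsion_free[OF lift_vfield[OF X'] lift_vfield[OF Y'], symmetric]
      N.torsion_free[OF X' Y', symmetric] lift_diff[OF XY YX] by simp
  then have "g p (D (lie_bracket (lift X') (lift Y')) (lift Z') p) (lift W' p) =
      g' (\<pi> p) (D' (lie_bracket X' Y') Z' (\<pi> p)) (W' (\<pi> p)) - g p (V p) (vpart Z' W' p)"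
    using lifts_connection_metric[OF lift[OF br] lift[OF Z'] lift[OF W'] br Z' W', of p] D_vertical[OF V vert Z' W', of p]
    by (simp add: D_add_left metric_add_left vfieldD D_vfield lift_vfield br V Z' W')
  moreover have "g p (V p) (vpart Z' W' p) = 2 * g p (vpart X' Y' p) (vpart Z' W' p)"
  proof -
    have "g p (V p) (vpart Z' W' p) = g p (vpart X' Y' p) (vpart Z' W' p) - g p (vpart Y' X' p) (vpart Z' W' p)"
      by (simp add: V_def metric_diff_left vfieldD vpart_vfield X' Y' Z' W')
    then show ?thesis
      by (simp add: vpart_skew[OF X' Y'] metric_uminus_left vfieldD vpart_vfield X' Y' Z' W')
  qed
  ultimately show ?thesis
    using first[OF X' Y'] first[OF Y' X']
    by (simp add: curvature_eq N.curvature_eq lift_vfield X' Y' Z' W')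
qed

section \<open>Comparison with the O'Neill tensor\<close>

text \<open>Evaluates the projections, given by \<open>THE\<close>, once a decomposition is in hand;
  for lifts and their covariant derivatives one is known.\<close>

lemma proj_eq:
  assumes "u \<in> \<H> p" "w \<in> \<V> p" "X p = u + w"
  shows "horizontal_proj M g N \<pi> X p = u" "vertical_proj M g N \<pi> X p = w"
proof -
  have uniq: "u' = u" if "u' \<in> \<H> p" "X p - u' \<in> \<V> p" for u'
  proof (rule horizontal_unique[OF that(1) assms(1)])
    show "d\<pi> u' = d\<pi> u"
      using that(2) assms(2,3) by (simp add: vertical_space_def differential_minus differential_plus)
  qed
  show "horizontal_proj M g N \<pi> X p = u"
    unfolding horizontal_proj_def
  proof (rule the_equality)
    show "u' = u" if "u' \<in> \<H> p \<and> X p - u' \<in> \<V> p" for u'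
      using uniq that by blast
  qed (simp add: assms)
  show "vertical_proj M g N \<pi> X p = w"
    unfolding vertical_proj_def
  proof (rule the_equality)
    show "w' = w" if "w' \<in> \<V> p \<and> X p - w' \<in> \<H> p" for w'
    proof -
      have "X p - (X p - w') \<in> \<V> p" using that by simp
      then have "X p - w' = u" using uniq that by blast
      then show ?thesis using assms(3) by (metis add_diff_cancel_left' diff_diff_eq2 add.commute)
    qed
  qed (simp add: assms)
qed

text \<open>Lifts have vertical projection 0, so the second summand of A is the projection of
  \<open>D (lift X') 0\<close>, which vanishes.\<close>

lemma oneill_A_lift:
  assumes X': "X' \<in> vector_fields N" and Y': "Y' \<in> vector_fields N"
  shows "oneill_A M g D N \<pi> (lift X') (lift Y') = vpart X' Y'"
proof -
  have zero: "0 \<in> \<H> p" "0 \<in> \<V> p" for p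
    by (auto simp: horizontal_space_def vertical_space_def tangent_zero differential_zero metric_zero_left)
  have h: "horizontal_proj M g N \<pi> (lift Z') = lift Z'" "vertical_proj M g N \<pi> (lift Z') = 0"
    if "Z' \<in> vector_fields N" for Z'
    using proj_eq[OF liftsD(2)[OF lift[OF that]] zero(2), of "lift Z'"] by (auto simp: fun_eq_iff)
  have "horizontal_proj M g N \<pi> 0 = 0"
    using proj_eq(1)[OF zero, of 0] by (auto simp: fun_eq_iff)
  moreover have "vertical_proj M g N \<pi> (D (lift X') (lift Y')) = vpart X' Y'"
    using proj_eq(2)[OF liftsD(2)[OF lift[OF N.D_vfield[OF X' Y']]] vpart_vertical[OF X' Y'], of "D (lift X') (lift Y')"]
    by (auto simp: vpart_def fun_eq_iff)
  ultimately show ?thesis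
    using X' Y' by (simp add: oneill_A_def Let_def h D_zero_right lift_vfield)
qed

end

section \<open>Contact-complex submersions\<close>


locale contact_complex = levi_civita_submersion M g N g' \<pi> D D'
  for M :: "('m::{t2_space,second_countable_topology}, 'e::euclidean_space) atlas" and g
    and N :: "('n::{t2_space,second_countable_topology}, 'd::euclidean_space) atlas" and g' and \<pi> and D D' +
  fixes \<phi> :: "'m \<Rightarrow> 'm tvec \<Rightarrow> 'm tvec" and \<xi> :: "'m vfield" and \<eta> :: "'m \<Rightarrow> 'm tvec \<Rightarrow> real"
    and J :: "'n \<Rightarrow> 'n tvec \<Rightarrow> 'n tvec"
  assumes contact_complex: "contact_complex_submersion M \<phi> \<xi> \<eta> g N J g' \<pi>"
begin

lemma almost_contact: "almost_contact_metric_manifold M \<phi> \<xi> \<eta> g"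
  and almost_hermitian: "almost_hermitian_manifold N J g'"
  and differential_phi: "u \<in> tangent_space M p \<Longrightarrow> d\<pi> (\<phi> p u) = J (\<pi> p) (d\<pi> u)"
  using contact_complex by (simp_all add: contact_complex_submersion_def)

section \<open>Identities of the almost contact structure\<close>

lemma phi_tensor: "tensor_field_11 M \<phi>"
  and xi_vfield: "\<xi> \<in> vector_fields M"
  and phi_phi: "u \<in> tangent_space M p \<Longrightarrow> \<phi> p (\<phi> p u) = - u + \<eta> p u *\<^sub>v \<xi> p"
  and eta_xi: "\<eta> p (\<xi> p) = 1"
  and metric_phi_phi: "u \<in> tangent_space M p \<Longrightarrow> w \<in> tangent_space M p \<Longrightarrow>
    g p (\<phi> p u) (\<phi> p w) = g p u w - \<eta> p u * \<eta> p w"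
  using almost_contact by (simp_all add: almost_contact_metric_manifold_def)

lemma phi_tangent: "u \<in> tangent_space M p \<Longrightarrow> \<phi> p u \<in> tangent_space M p"
  and phi_scale: "u \<in> tangent_space M p \<Longrightarrow> \<phi> p (c *\<^sub>v u) = c *\<^sub>v \<phi> p u"
  and phi_add: "u \<in> tangent_space M p \<Longrightarrow> w \<in> tangent_space M p \<Longrightarrow> \<phi> p (u + w) = \<phi> p u + \<phi> p w"
  and phi_vfield: "X \<in> vector_fields M \<Longrightarrow> apply_tensor \<phi> X \<in> vector_fields M"
  using phi_tensor by (simp_all add: tensor_field_11_def)

lemma xi_tangent: "\<xi> p \<in> tangent_space M p"
  by (rule vfieldD[OF xi_vfield])

text \<open>Otherwise the compatibility of g with \<phi>, read at the zero vector, would force the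
  square of \<eta> (\<xi>) to be 0.\<close>

lemma xi_nonzero: "\<xi> p \<noteq> 0"
proof
  assume "\<xi> p = 0"
  moreover have "\<phi> p 0 = 0" using phi_scale[OF tangent_zero, of p 0] by simp
  ultimately have "g p 0 0 - \<eta> p (\<xi> p) * \<eta> p (\<xi> p) = g p 0 0"
    using metric_phi_phi[OF tangent_zero tangent_zero, of p] by simp
  then show False using eta_xi by simp
qed

text \<open>The formula for the square of \<phi> gives \<phi> (\<phi> \<xi>) = 0, and, read at
  \<phi> \<xi>, it gives \<phi> \<xi> = c \<xi>. Applying \<phi> once more shows that c squared
  times \<xi> is 0.\<close>

lemma phi_xi: "\<phi> p (\<xi> p) = 0"
proof -
  let ?c = "\<eta> p (\<phi> p (\<xi> p))"
  have z: "\<phi> p (\<phi> p (\<xi> p)) = 0"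
    using phi_phi[OF xi_tangent, of p] by (simp add: eta_xi)
  have "\<phi> p 0 = 0" using phi_scale[OF tangent_zero, of p 0] by simp
  then have eq: "\<phi> p (\<xi> p) = ?c *\<^sub>v \<xi> p"
    using phi_phi[OF phi_tangent[OF xi_tangent], of p] by (simp add: z)
  have "?c *\<^sub>v \<phi> p (\<xi> p) = 0"
    using phi_scale[OF xi_tangent, of p ?c] z eq by simp
  then have "(?c * ?c) *\<^sub>v \<xi> p = 0" using eq by (metis scale_vec_simps(6))
  then have "?c = 0"
    using xi_nonzero[of p] by (auto simp: fun_eq_iff)
  then show ?thesis using eq by simp
qed

text \<open>Compute the cube of \<phi> in two ways. As \<phi> of the square it is
  \<open>- \<phi> p u\<close>, since \<phi> \<xi> = 0; as the square at \<phi> u it has the extra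
  term \<eta> (\<phi> u) \<xi>.\<close>

lemma eta_phi: "u \<in> tangent_space M p \<Longrightarrow> \<eta> p (\<phi> p u) = 0"
proof -
  assume u: "u \<in> tangent_space M p"
  have m: "- u = (- 1) *\<^sub>v u" by (simp add: scale_vec_def fun_eq_iff)
  have "\<phi> p (\<phi> p (\<phi> p u)) = \<phi> p ((- 1) *\<^sub>v u + \<eta> p u *\<^sub>v \<xi> p)"
    by (simp only: phi_phi[OF u] m)
  also have "\<dots> = - \<phi> p u"
    by (simp add: phi_add phi_scale u xi_tangent tangent_scale_vec phi_xi) (simp add: fun_eq_iff)
  finally have "\<eta> p (\<phi> p u) *\<^sub>v \<xi> p = 0"
    using phi_phi[OF phi_tangent[OF u]] by simp
  then show ?thesis using xi_nonzero[of p] by (auto simp: fun_eq_iff)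
qed

text \<open>Put \<xi> into the compatibility of g with \<phi>: the left side vanishes because \<phi>
  \<xi> = 0.\<close>

lemma metric_xi: "u \<in> tangent_space M p \<Longrightarrow> g p u (\<xi> p) = \<eta> p u"
  using metric_phi_phi[OF _ xi_tangent, of u p] metric_scale_right[OF xi_tangent phi_tangent, of u p 0]
  by (simp add: phi_xi eta_xi)

text \<open>Up to a multiple of \<xi>, a vertical w equals - \<phi> (\<phi> w). The product of
  \<phi> u with \<phi> (\<phi> w) reduces to that of u with the vertical vector \<phi> w, and \<phi>
  u is orthogonal to \<xi>.\<close>

lemma phi_horizontal:
  assumes u: "u \<in> \<H> p"
  shows "\<phi> p u \<in> \<H> p"
proof -
  have uT: "u \<in> tangent_space M p" using u by (simp add: horizontal_space_def)
  \<comment> \<open>This is J (d\<pi> 0) = d\<pi> (\<phi> 0), so vertical vectors stay vertical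
    under \<phi>.\<close>
  have J0: "J (\<pi> p) 0 = 0"
    using differential_phi[OF xi_tangent, of p] differential_phi[OF phi_tangent[OF xi_tangent], of p]
      differential_phi[OF tangent_zero, of p] phi_scale[OF tangent_zero, of p 0] by (simp add: differential_zero)
  have "g p (\<phi> p u) w = 0" if w: "w \<in> \<V> p" for w
  proof -
    have wT: "w \<in> tangent_space M p" using w by (simp add: vertical_space_def)
    have "\<phi> p w \<in> \<V> p"
      using w by (simp add: vertical_space_def phi_tangent differential_phi J0)
    then have "g p (\<phi> p u) (\<phi> p (\<phi> p w)) = 0"
      using vertical_horizontal(2)[OF _ u, of "\<phi> p w"] by (simp add: metric_phi_phi uT phi_tangent wT eta_phi)
    moreover have "\<phi> p (\<phi> p w) = \<eta> p w *\<^sub>v \<xi> p - w"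
      using phi_phi[OF wT] by simp
    ultimately show ?thesis
      using metric_xi[OF phi_tangent[OF uT]]
      by (simp add: metric_diff_right metric_scale_right tangent_scale_vec xi_tangent phi_tangent uT wT eta_phi)
  qed
  then show ?thesis by (simp add: horizontal_space_def phi_tangent uT)
qed

lemma J_vfield: "X' \<in> vector_fields N \<Longrightarrow> apply_tensor J X' \<in> vector_fields N"
  using almost_hermitian by (simp add: almost_hermitian_manifold_def tensor_field_11_def)

lemma J_J: "X' \<in> vector_fields N \<Longrightarrow> apply_tensor J (apply_tensor J X') = - X'"
  using almost_hermitian by (simp add: almost_hermitian_manifold_def apply_tensor_def N.vfieldD fun_eq_iff)

lemma lift_J:
  assumes "X' \<in> vector_fields N"
  shows "lift (apply_tensor J X') = apply_tensor \<phi> (lift X')"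
proof (rule lift_eq[OF _ J_vfield[OF assms]])
  note L = liftsD[OF lift[OF assms]]
  show "lifts (apply_tensor \<phi> (lift X')) (apply_tensor J X')"
    using phi_vfield[OF L(1)] by (simp add: lifts_def apply_tensor_def phi_horizontal L(2,3) differential_phi L(4))
qed

lemma lift_horizontal: "X' \<in> vector_fields N \<Longrightarrow> lift X' \<in> horizontal_fields M g N \<pi>"
  using liftsD(1,2)[OF lift] by (simp add: horizontal_fields_def)

section \<open>Transfer of the curvature identity to the base\<close>

lemma K2_identity_at_image:
  assumes bil: "phi_bilinear M \<phi> g N \<pi> (oneill_A M g D N \<pi>)"
    and K: "K2phi M \<phi> g D"
    and X': "X' \<in> vector_fields N" and Y': "Y' \<in> vector_fields N" and Z': "Z' \<in> vector_fields N"
    and W': "W' \<in> vector_fields N"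
  shows "curvature g' D' X' Y' Z' W' (\<pi> p) =
    curvature g' D' (apply_tensor J X') Y' Z' (apply_tensor J W') (\<pi> p) +
    curvature g' D' X' (apply_tensor J Y') Z' (apply_tensor J W') (\<pi> p) +
    curvature g' D' X' Y' (apply_tensor J Z') (apply_tensor J W') (\<pi> p)"
proof -
  let ?J = "apply_tensor J"
  have bilin: "vpart (?J U) V p = \<phi> p (vpart U V p)" "vpart U (?J V) p = \<phi> p (vpart U V p)"
    if U: "U \<in> vector_fields N" and V: "V \<in> vector_fields N" for U V
  proof -
    have "oneill_A M g D N \<pi> (lift (?J U)) (lift V) = oneill_A M g D N \<pi> (lift U) (lift (?J V))"
      "oneill_A M g D N \<pi> (lift U) (lift (?J V)) = apply_tensor \<phi> (oneill_A M g D N \<pi> (lift U) (lift V))"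
      using bil lift_horizontal[OF U] lift_horizontal[OF V] unfolding phi_bilinear_def lift_J[OF U] lift_J[OF V]
      by blast+
    then have "vpart (?J U) V = vpart U (?J V)" "vpart U (?J V) = apply_tensor \<phi> (vpart U V)"
      by (simp_all add: oneill_A_lift U V J_vfield)
    then show "vpart (?J U) V p = \<phi> p (vpart U V p)" "vpart U (?J V) p = \<phi> p (vpart U V p)"
      by (simp_all add: apply_tensor_def)
  qed
  have T: "vpart U V p \<in> tangent_space M p" if "U \<in> vector_fields N" "V \<in> vector_fields N" for U V
    by (rule vfieldD[OF vpart_vfield[OF that]])
  have eta: "\<eta> p (vpart U V p) = 0" if U: "U \<in> vector_fields N" and V: "V \<in> vector_fields N" for U V
  proof -
    have "\<phi> p (\<phi> p (vpart U V p)) = - vpart U V p"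
      using bilin(1)[OF J_vfield[OF U] V] by (simp add: bilin(1)[OF U V] J_J[OF U] vpart_uminus_left U V)
    then have "\<eta> p (vpart U V p) *\<^sub>v \<xi> p = 0"
      using phi_phi[OF T[OF U V]] by simp
    then show ?thesis using xi_nonzero[of p] by (auto simp: fun_eq_iff)
  qed
  have iso: "g p (\<phi> p a) (\<phi> p b) = g p a b" 
    and sq: "g p a (\<phi> p (\<phi> p b)) = - g p a b" "g p (\<phi> p (\<phi> p b)) a = - g p b a"
    if "a \<in> tangent_space M p" "b \<in> tangent_space M p" "\<eta> p a = 0" "\<eta> p b = 0" for a b
    using that metric_uminus_left[OF that(2,1)] metric_sym[OF that(1) tangent_uminus[OF that(2)]] metric_sym[OF that(1,2)]
    by (simp_all add: metric_phi_phi phi_phi)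
  have "curvature g D (lift X') (lift Y') (lift Z') (lift W') p =
      curvature g D (lift (?J X')) (lift Y') (lift Z') (lift (?J W')) p +
      curvature g D (lift X') (lift (?J Y')) (lift Z') (lift (?J W')) p +
      curvature g D (lift X') (lift Y') (lift (?J Z')) (lift (?J W')) p"
  proof -
    have "curvature g D (lift X') (lift Y') (lift Z') (lift W') =
      curvature g D (lift (?J X')) (lift Y') (lift Z') (lift (?J W')) +
      curvature g D (lift X') (lift (?J Y')) (lift Z') (lift (?J W')) +
      curvature g D (lift X') (lift Y') (lift (?J Z')) (lift (?J W'))"
      using K lift_vfield[OF X'] lift_vfield[OF Y'] lift_vfield[OF Z'] lift_vfield[OF W']
      unfolding K2phi_def lift_J[OF X'] lift_J[OF Y'] lift_J[OF Z'] lift_J[OF W'] by blast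
    from fun_cong[OF this, of p] show ?thesis by simp
  qed
  \<comment> \<open>Each quadratic term occurs three times with two copies of \<phi> inserted: twice
    with one copy on each factor, which by \<open>iso\<close> returns the term, and once with both
    copies on the same factor, which by \<open>sq\<close> returns its negative. The total 1 + 1 - 1
    = 1 is the required identity.\<close>
  then show ?thesis
    by (simp add: oneill_curvature X' Y' Z' W' J_vfield bilin iso sq T eta phi_tangent)
qed

end

theorem proposition3p7:
  fixes M :: "('m::{t2_space,second_countable_topology}, 'e::euclidean_space) atlas"
    and N :: "('n::{t2_space,second_countable_topology}, 'd::euclidean_space) atlas"
    and \<phi> :: "'m \<Rightarrow> 'm tvec \<Rightarrow> 'm tvec" and \<xi> :: "'m vfield" and \<eta> :: "'m \<Rightarrow> 'm tvec \<Rightarrow> real"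
    and J :: "'n \<Rightarrow> 'n tvec \<Rightarrow> 'n tvec"
    and g :: "'m metric" and g' :: "'n metric"
    and D :: "'m connection" and D' :: "'n connection"
    and \<pi> :: "'m \<Rightarrow> 'n"
  assumes "contact_complex_submersion M \<phi> \<xi> \<eta> g N J g' \<pi>"
    and "levi_civita_connection M g D"
    and "levi_civita_connection N g' D'"
    and "K2phi M \<phi> g D"
    and "phi_bilinear M \<phi> g N \<pi> (oneill_A M g D N \<pi>)"
  shows "K2 N J g' D'"
proof -
  have sub: "riemannian_submersion M g N g' \<pi>"
    using assms(1) by (simp add: contact_complex_submersion_def)
  then have "smooth_manifold M" "riemannian_metric M g" "smooth_manifold N" "riemannian_metric N g'"
    and surj: "surj \<pi>"
    by (simp_all add: riemannian_submersion_def riemannian_manifold_def)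
  with sub assms(1-3) interpret contact_complex M g N g' \<pi> D D' \<phi> \<xi> \<eta> J
    by unfold_locales
  have "curvature g' D' X Y Z W q = (curvature g' D' (apply_tensor J X) Y Z (apply_tensor J W) +
      curvature g' D' X (apply_tensor J Y) Z (apply_tensor J W) +
      curvature g' D' X Y (apply_tensor J Z) (apply_tensor J W)) q"
    if "X \<in> vector_fields N" "Y \<in> vector_fields N" "Z \<in> vector_fields N" "W \<in> vector_fields N" for X Y Z W q
  proof -
    obtain p where "q = \<pi> p" using surj by (metis surjD)
    then show ?thesis
      using K2_identity_at_image[OF assms(5,4) that, of p] by simp
  qed
  then show ?thesis
    unfolding K2_def by (intro ballI ext)
qed

end
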